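(* Let $G$ and $H$ be finitely generated free groups, and let $\operatorname{ED}(G,H)$ be the expected value of the density $D(\phi(G))$ of the image of a homomorphism $\phi:G\to H$, defined by \[ \operatorname{ED}(G,H)=\lim_{p\to\infty}\frac1{|H_p|^{r}}\sum_{\phi\in(H_p)^r}D(\phi(G)), \] where $r$ is the rank of $G$. \begin{enumerate} \item If the rank of $H$ is $1$ and the rank of $G$ is $n>1$, then \[ \operatorname{ED}(G,H)=\frac{\zeta(n+1)}{\zeta(n)}, \] where $\zeta$ is the Riemann zeta function. \item If the ranks of $G$ and $H$ are both $1$, or if the rank of $H$ is greater than $1$, then \[ \operatorname{ED}(G,H)=0. \] \end{enumerate}
   Context: Fix free generators $a_1,\dots,a_r$ of $G$ and a free generating set of $H$. A homomorphism $\phi:G\to H$ is identified with the $r$-tuple $(\phi(a_1),\dots,\phi(a_r))\in H^r$. For a natural number $p$, $H_p$ is the set of elements of $H$ of reduced word length at most $p$, and $|H_p|$ is its cardinality. The asymptotic density of a subset $S\subset H$ is $D(S)=\lim_{p\to\infty}|S\cap H_p|/|H_p|$.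
   Formalization: The limit defining D(φ(G)) need not exist when H has rank greater than 1 (e.g. for the even-length subgroup); such images are given arbitrary values in [0,1], and the result is proved for every such choice. *)

theory Defs
  imports Complex_Main "HOL-Algebra.Group"
begin

text \<open>A word is a list of letters; the letter \<open>(x, True)\<close> stands for \<open>x\<close> and
  \<open>(x, False)\<close> for the inverse of \<open>x\<close>.\<close>

definition word_val :: "('a, 'm) monoid_scheme \<Rightarrow> ('a \<times> bool) list \<Rightarrow> 'a" where
  "word_val G w =
     foldr (\<lambda>(x, b) g. (if b then x else inv\<^bsub>G\<^esub> x) \<otimes>\<^bsub>G\<^esub> g) w \<one>\<^bsub>G\<^esub>"

definition reduced_words :: "'a set \<Rightarrow> ('a \<times> bool) list set" where
  "reduced_words X =
     {w. set w \<subseteq> X \<times> UNIV \<and> successively (\<lambda>(x, b) (y, c). x = y \<longrightarrow> b = c) w}"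

definition free_basis :: "('a, 'm) monoid_scheme \<Rightarrow> 'a set \<Rightarrow> bool" where
  "free_basis G X \<longleftrightarrow>
     group G \<and> X \<subseteq> carrier G \<and> bij_betw (word_val G) (reduced_words X) (carrier G)"

definition word_length :: "('a, 'm) monoid_scheme \<Rightarrow> 'a set \<Rightarrow> 'a \<Rightarrow> nat" where
  "word_length G X g = length (the_inv_into (reduced_words X) (word_val G) g)"

definition word_ball :: "('a, 'm) monoid_scheme \<Rightarrow> 'a set \<Rightarrow> nat \<Rightarrow> 'a set" where
  "word_ball G X p = {g \<in> carrier G. word_length G X g \<le> p}"

definition density_seq :: "('a, 'm) monoid_scheme \<Rightarrow> 'a set \<Rightarrow> 'a set \<Rightarrow> nat \<Rightarrow> real" where
  "density_seq H Y S p = real (card (S \<inter> word_ball H Y p)) / real (card (word_ball H Y p))"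

text \<open>The limit defining the density need not exist, not even for finitely generated
  subgroups: the elements of even length in a free group of rank at least 2 form a subgroup of
  index 2 whose relative frequency in the ball of radius \<open>p\<close> oscillates with the
  parity of \<open>p\<close>. The parameter \<open>c\<close> provides the value in that case.\<close>

definition density ::
  "('a, 'm) monoid_scheme \<Rightarrow> 'a set \<Rightarrow> ('a set \<Rightarrow> real) \<Rightarrow> 'a set \<Rightarrow> real" where
  "density H Y c S =
     (if convergent (density_seq H Y S) then lim (density_seq H Y S) else c S)"

text \<open>The homomorphisms that send the basis \<open>X\<close> into the ball of radius \<open>p\<close>, that is, the
  tuples in \<open>(H_p)^r\<close>. Extensionality makes a homomorphism determined by its
  restriction to the carrier, so that each one is counted once.\<close>

definition ball_homs ::
  "('a, 'm) monoid_scheme \<Rightarrow> 'a set \<Rightarrow> ('b, 'n) monoid_scheme \<Rightarrow> 'b set \<Rightarrow> nat \<Rightarrow> ('a \<Rightarrow> 'b) set"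
  where
  "ball_homs G X H Y p =
     {\<phi> \<in> hom G H \<inter> extensional (carrier G). \<phi> ` X \<subseteq> word_ball H Y p}"

definition mean_density ::
  "('a, 'm) monoid_scheme \<Rightarrow> 'a set \<Rightarrow> ('b, 'n) monoid_scheme \<Rightarrow> 'b set \<Rightarrow> ('b set \<Rightarrow> real) \<Rightarrow> nat \<Rightarrow> real"
  where
  "mean_density G X H Y c p =
     1 / real (card (word_ball H Y p)) ^ card X *
       (\<Sum>\<phi> \<in> ball_homs G X H Y p. density H Y c (\<phi> ` carrier G))"

definition has_expected_density ::
  "('a, 'm) monoid_scheme \<Rightarrow> 'a set \<Rightarrow> ('b, 'n) monoid_scheme \<Rightarrow> 'b set \<Rightarrow> ('b set \<Rightarrow> real) \<Rightarrow> real \<Rightarrow> bool"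
  where
  "has_expected_density G X H Y c L \<longleftrightarrow> mean_density G X H Y c \<longlonglongrightarrow> L"

text \<open>Only meaningful for \<open>s > 1\<close>, where the series converges.\<close>

definition zeta :: "real \<Rightarrow> real" where
  "zeta s = (\<Sum>k. 1 / real (Suc k) powr s)"

end

theory Submission
  imports Defs "HOL-Analysis.Uniform_Limit" "HOL-Real_Asymp.Real_Asymp"
    "HOL-Computational_Algebra.Squarefree"
begin

text \<open>Suppose first that \<open>H\<close> has rank at least 2, and let \<open>m\<close> be about \<open>p / 4\<close>. For all but
  a proportion \<open>O(3 ^ - m)\<close> of the tuples in the ball of radius \<open>p\<close>, the entries are long and
  no two of the entries and their inverses share their first \<open>m\<close> letters. In a reduced
  product of \<open>l\<close> such elements little cancels, so it has length at least \<open>m * l\<close>. Hence the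
  image meets the ball of radius \<open>q\<close> in at most \<open>(2 r + 1) ^ (q div m) \<le> 2 ^ q\<close> elements,
  whereas the ball has at least \<open>3 ^ q\<close>, and the density is 0. The other tuples contribute at
  most their proportion, whatever value \<open>c\<close> assigns to images without a density.

  If \<open>H\<close> is infinite cyclic, the image of a tuple has density \<open>1 / g\<close>, with \<open>g\<close> the gcd of the
  exponents. The tuples in the box of size \<open>q\<close> with gcd \<open>g\<close> correspond to the primitive ones in
  the box of size \<open>q div g\<close>, so every mean involved is a sum over \<open>g\<close> to which Tannery's
  theorem applies.\<close>

section \<open>Reduced words\<close>

definition inv_letter :: "'a \<times> bool \<Rightarrow> 'a \<times> bool" where
  "inv_letter s = (fst s, \<not> snd s)"

definition inv_word :: "('a \<times> bool) list \<Rightarrow> ('a \<times> bool) list" where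
  "inv_word w = rev (map inv_letter w)"

lemma inv_letter_inv_letter [simp]: "inv_letter (inv_letter s) = s"
  by (simp add: inv_letter_def)

lemma inv_letter_in_iff [simp]: "inv_letter s \<in> X \<times> UNIV \<longleftrightarrow> s \<in> X \<times> UNIV"
  by (auto simp: inv_letter_def mem_Times_iff)

lemma length_inv_word [simp]: "length (inv_word w) = length w"
  by (simp add: inv_word_def)

lemma inv_word_Nil [simp]: "inv_word [] = []"
  by (simp add: inv_word_def)

lemma inv_word_Cons [simp]: "inv_word (s # w) = inv_word w @ [inv_letter s]"
  by (simp add: inv_word_def)

lemma inv_word_append [simp]: "inv_word (v @ w) = inv_word w @ inv_word v"
  by (simp add: inv_word_def)

lemma inv_word_inv_word [simp]: "inv_word (inv_word w) = w"
  by (induction w) simp_all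

text \<open>Two letters on the same generator with different signs are mutually inverse, so the
  condition on neighbours is preserved by reversing and inverting a word, as
  \<open>inv_word_reduced\<close> needs.\<close>

lemma mem_reduced_words_iff:
  "w \<in> reduced_words X \<longleftrightarrow> set w \<subseteq> X \<times> UNIV \<and> successively (\<lambda>s t. t \<noteq> inv_letter s) w"
proof -
  have "(\<lambda>(x :: 'a, b) (y, c). x = y \<longrightarrow> b = c) = (\<lambda>s t. t \<noteq> inv_letter s)"
    by (auto simp: fun_eq_iff inv_letter_def)
  then show ?thesis
    by (simp add: reduced_words_def)
qed

lemma Nil_reduced [simp]: "[] \<in> reduced_words X"
  by (simp add: mem_reduced_words_iff)

lemma Cons_reduced_iff:
  "s # w \<in> reduced_words X \<longleftrightarrow>
     s \<in> X \<times> UNIV \<and> w \<in> reduced_words X \<and> (w = [] \<or> hd w \<noteq> inv_letter s)"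
  by (auto simp: mem_reduced_words_iff successively_Cons)

lemma append_reduced_iff:
  "v @ w \<in> reduced_words X \<longleftrightarrow>
     v \<in> reduced_words X \<and> w \<in> reduced_words X \<and>
     (v = [] \<or> w = [] \<or> hd w \<noteq> inv_letter (last v))"
  by (auto simp: mem_reduced_words_iff successively_append_iff)

lemma inv_word_reduced:
  assumes "w \<in> reduced_words X"
  shows "inv_word w \<in> reduced_words X"
proof -
  have "successively (\<lambda>s t. t \<noteq> inv_letter s) (inv_word w)"
    unfolding inv_word_def successively_rev successively_map
    by (rule successively_mono[where P = "\<lambda>s t. t \<noteq> inv_letter s"])
       (use assms in \<open>auto simp: mem_reduced_words_iff\<close>)
  moreover have "set (inv_word w) \<subseteq> X \<times> UNIV"
    using assms by (auto simp: mem_reduced_words_iff inv_word_def inv_letter_def)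
  ultimately show ?thesis
    by (simp add: mem_reduced_words_iff)
qed

lemma drop_reduced: "w \<in> reduced_words X \<Longrightarrow> drop n w \<in> reduced_words X"
  by (metis append_reduced_iff append_take_drop_id)

section \<open>Free reduction of words\<close>

fun push_letter :: "'a \<times> bool \<Rightarrow> ('a \<times> bool) list \<Rightarrow> ('a \<times> bool) list" where
  "push_letter s [] = [s]"
| "push_letter s (t # w) = (if t = inv_letter s then w else s # t # w)"

text \<open>Folding from the right keeps the tail reduced, so each new letter cancels at most once
  and a single pass suffices.\<close>

definition reduce :: "('a \<times> bool) list \<Rightarrow> ('a \<times> bool) list" where
  "reduce w = foldr push_letter w []"

lemma push_letter_reduced:
  assumes "s \<in> X \<times> UNIV" "w \<in> reduced_words X"
  shows "push_letter s w \<in> reduced_words X"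
  using assms by (cases w) (auto simp: Cons_reduced_iff)

lemma reduce_reduced: "set w \<subseteq> X \<times> UNIV \<Longrightarrow> reduce w \<in> reduced_words X"
  by (induction w) (auto simp: reduce_def intro!: push_letter_reduced)

lemma reduced_words_letters: "w \<in> reduced_words X \<Longrightarrow> set w \<subseteq> X \<times> UNIV"
  by (simp add: mem_reduced_words_iff)


section \<open>Values of words\<close>

definition letter_val :: "('a, 'm) monoid_scheme \<Rightarrow> 'a \<times> bool \<Rightarrow> 'a" where
  "letter_val G s = (if snd s then fst s else inv\<^bsub>G\<^esub> (fst s))"

lemma word_val_Nil [simp]: "word_val G [] = \<one>\<^bsub>G\<^esub>"
  by (simp add: word_val_def)

lemma word_val_Cons: "word_val G (s # w) = letter_val G s \<otimes>\<^bsub>G\<^esub> word_val G w"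
  by (simp add: word_val_def letter_val_def split_beta)

lemma set_map_apfst_subset:
  assumes "f \<in> X \<rightarrow> Z" "set w \<subseteq> X \<times> UNIV"
  shows "set (map (apfst f) w) \<subseteq> Z \<times> UNIV"
  using assms by (fastforce simp: Pi_iff)

context group
begin

lemma letter_val_closed: "s \<in> carrier G \<times> UNIV \<Longrightarrow> letter_val G s \<in> carrier G"
  by (auto simp: letter_val_def)

lemma letter_val_inv_letter:
  "s \<in> carrier G \<times> UNIV \<Longrightarrow> letter_val G (inv_letter s) = inv (letter_val G s)"
  by (auto simp: letter_val_def inv_letter_def)

lemma word_val_closed: "set w \<subseteq> carrier G \<times> UNIV \<Longrightarrow> word_val G w \<in> carrier G"
  by (induction w) (auto simp: word_val_Cons letter_val_closed)

lemma word_val_append: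
  "set v \<subseteq> carrier G \<times> UNIV \<Longrightarrow> set w \<subseteq> carrier G \<times> UNIV \<Longrightarrow>
     word_val G (v @ w) = word_val G v \<otimes> word_val G w"
  by (induction v) (auto simp: word_val_Cons letter_val_closed word_val_closed m_assoc)

lemma word_val_inv_word:
  "set w \<subseteq> carrier G \<times> UNIV \<Longrightarrow> word_val G (inv_word w) = inv (word_val G w)"
proof (induction w)
  case (Cons s w)
  have "set (inv_word w) \<subseteq> carrier G \<times> UNIV"
    using Cons.prems by (auto simp: inv_word_def inv_letter_def)
  then show ?case
    using Cons by (simp add: word_val_append word_val_Cons letter_val_closed
        letter_val_inv_letter word_val_closed inv_mult_group)
qed simp

text \<open>The letters are evaluated through an arbitrary map \<open>f\<close>: the choice
  \<open>f = id\<close> gives reduction inside a free group, and arbitrary images of a basis give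
  the extension of a map to a homomorphism.\<close>

lemma word_val_map_push_letter:
  assumes "f \<in> X \<rightarrow> carrier G" "s \<in> X \<times> UNIV" "set w \<subseteq> X \<times> UNIV"
  shows "word_val G (map (apfst f) (push_letter s w)) = word_val G (map (apfst f) (s # w))"
proof -
  have inv: "apfst f (inv_letter s) = inv_letter (apfst f s)"
    by (cases s) (simp add: inv_letter_def)
  have "letter_val G (apfst f s) \<in> carrier G"
    using assms by (intro letter_val_closed) auto
  moreover have "word_val G (map (apfst f) w) \<in> carrier G"
    using assms by (intro word_val_closed set_map_apfst_subset)
  \<comment> \<open>When \<open>s\<close> cancels against the head of \<open>w\<close>, what is left
    is \<open>tl w\<close>, so its value enters the associativity step.\<close>
  moreover have "word_val G (map (apfst f) (tl w)) \<in> carrier G"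
    using assms by (intro word_val_closed set_map_apfst_subset) (cases w; auto)+
  moreover have "apfst f s \<in> carrier G \<times> UNIV"
    using assms by auto
  ultimately show ?thesis
    by (cases w) (auto simp: inv word_val_Cons letter_val_inv_letter m_assoc[symmetric])
qed

lemma word_val_map_reduce:
  assumes "f \<in> X \<rightarrow> carrier G" "set w \<subseteq> X \<times> UNIV"
  shows "word_val G (map (apfst f) (reduce w)) = word_val G (map (apfst f) w)"
  using assms(2)
proof (induction w)
  case (Cons s w)
  have "reduce (s # w) = push_letter s (reduce w)"
    by (simp add: reduce_def)
  moreover have "set (reduce w) \<subseteq> X \<times> UNIV"
    using reduce_reduced[of w X] Cons.prems reduced_words_letters by auto
  ultimately show ?case
    using Cons word_val_map_push_letter[OF assms(1), of s "reduce w"]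
    by (simp add: word_val_Cons)
qed (simp add: reduce_def)

end

lemma hom_word_val:
  assumes "group G" "group K" "\<phi> \<in> hom G K" "set w \<subseteq> carrier G \<times> UNIV"
  shows "\<phi> (word_val G w) = word_val K (map (apfst \<phi>) w)"
proof -
  interpret group_hom G K \<phi>
    using assms by (simp add: group_hom_def group_hom_axioms_def)
  have "\<phi> (letter_val G s) = letter_val K (apfst \<phi> s)" if "s \<in> carrier G \<times> UNIV" for s
    using that by (auto simp: letter_val_def)
  with assms(4) show ?thesis
    by (induction w) (simp_all add: word_val_Cons G.letter_val_closed G.word_val_closed)
qed


section \<open>Free groups\<close>

locale free_group = group G for G (structure) +
  fixes X :: "'a set"
  assumes basis: "free_basis G X"
begin

abbreviation reduced_form :: "'a \<Rightarrow> ('a \<times> bool) list" where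
  "reduced_form \<equiv> the_inv_into (reduced_words X) (word_val G)"

lemma basis_subset: "X \<subseteq> carrier G"
  using basis by (simp add: free_basis_def)

lemma bij_word_val: "bij_betw (word_val G) (reduced_words X) (carrier G)"
  using basis by (simp add: free_basis_def)

lemma letters_carrier: "set w \<subseteq> X \<times> UNIV \<Longrightarrow> set w \<subseteq> carrier G \<times> UNIV"
  using basis_subset by auto

lemma reduced_letters_carrier: "w \<in> reduced_words X \<Longrightarrow> set w \<subseteq> carrier G \<times> UNIV"
  by (intro letters_carrier reduced_words_letters)

lemma reduced_form_reduced: "g \<in> carrier G \<Longrightarrow> reduced_form g \<in> reduced_words X"
  using bij_betw_the_inv_into[OF bij_word_val] by (auto simp: bij_betw_def)

lemma word_val_reduced_form: "g \<in> carrier G \<Longrightarrow> word_val G (reduced_form g) = g"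
  using bij_word_val by (metis bij_betw_def f_the_inv_into_f)

lemma reduced_form_word_val: "w \<in> reduced_words X \<Longrightarrow> reduced_form (word_val G w) = w"
  using bij_word_val by (simp add: bij_betw_def the_inv_into_f_f)

lemma word_length_word_val: "w \<in> reduced_words X \<Longrightarrow> word_length G X (word_val G w) = length w"
  by (simp add: word_length_def reduced_form_word_val)

text \<open>Reduction keeps the value, and a basis has only one reduced word for each value, so
  \<open>reduce\<close> must produce the normal form.\<close>

lemma reduced_form_word_val_reduce:
  assumes "set w \<subseteq> X \<times> UNIV"
  shows "reduced_form (word_val G w) = reduce w"
proof -
  have "id \<in> X \<rightarrow> carrier G"
    using basis_subset by auto
  then have "word_val G (reduce w) = word_val G w"
    using word_val_map_reduce[of id X w] assms by (simp)
  then show ?thesis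
    using reduced_form_word_val[OF reduce_reduced[OF assms]] by simp
qed

lemma word_val_single: "x \<in> X \<Longrightarrow> word_val G [(x, True)] = x"
  using basis_subset by (auto simp: word_val_Cons letter_val_def)

text \<open>The universal property of the basis: substitute \<open>f\<close> into the reduced form.
  Since reduction does not affect values in \<open>K\<close> either, any other word for the same
  element gives the same result, and concatenation of words yields multiplicativity.\<close>

lemma hom_extension:
  assumes "group K" "f \<in> X \<rightarrow> carrier K"
  obtains \<phi> where "\<phi> \<in> hom G K" "\<phi> \<in> extensional (carrier G)" "\<And>x. x \<in> X \<Longrightarrow> \<phi> x = f x"
proof
  interpret K: group K by fact
  define \<phi> where
    "\<phi> = restrict (\<lambda>g. word_val K (map (apfst f) (reduced_form g))) (carrier G)"
  show "\<phi> \<in> extensional (carrier G)"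
    by (simp add: \<phi>_def)
  have \<phi>_val: "\<phi> (word_val G w) = word_val K (map (apfst f) w)" if "set w \<subseteq> X \<times> UNIV" for w
    using that assms by (simp add: \<phi>_def word_val_closed letters_carrier reduced_form_word_val_reduce
        K.word_val_map_reduce)
  show "\<phi> x = f x" if "x \<in> X" for x
  proof -
    have "f x \<in> carrier K"
      using assms that by auto
    then have "word_val K (map (apfst f) [(x, True)]) = f x"
      by (simp add: word_val_Cons letter_val_def)
    with \<phi>_val[of "[(x, True)]"] show ?thesis
      using that word_val_single[OF that] by simp
  qed
  show "\<phi> \<in> hom G K"
  proof (rule homI)
    fix g assume g: "g \<in> carrier G"
    have "set (map (apfst f) (reduced_form g)) \<subseteq> carrier K \<times> UNIV"
      by (rule set_map_apfst_subset[OF assms(2)])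
         (use g in \<open>simp add: reduced_form_reduced reduced_words_letters\<close>)
    then show "\<phi> g \<in> carrier K"
      using g by (simp add: \<phi>_def K.word_val_closed)
  next
    fix g h assume gh: "g \<in> carrier G" "h \<in> carrier G"
    define v w where "v = reduced_form g" and "w = reduced_form h"
    have sub: "set v \<subseteq> X \<times> UNIV" "set w \<subseteq> X \<times> UNIV"
      using gh by (simp_all add: v_def w_def reduced_form_reduced reduced_words_letters)
    have "\<phi> (word_val G (v @ w)) = \<phi> (word_val G v) \<otimes>\<^bsub>K\<^esub> \<phi> (word_val G w)"
      using sub assms(2)
      by (simp add: \<phi>_val K.word_val_append set_map_apfst_subset del: set_map)
    then show "\<phi> (g \<otimes> h) = \<phi> g \<otimes>\<^bsub>K\<^esub> \<phi> h"
      using gh sub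
      by (simp add: word_val_append letters_carrier) (simp add: v_def w_def word_val_reduced_form)
  qed
qed

lemma hom_eqI:
  assumes "group K" "\<phi> \<in> hom G K \<inter> extensional (carrier G)" "\<psi> \<in> hom G K \<inter> extensional (carrier G)"
    and "\<And>x. x \<in> X \<Longrightarrow> \<phi> x = \<psi> x"
  shows "\<phi> = \<psi>"
proof (rule extensionalityI[where A = "carrier G"])
  fix g assume g: "g \<in> carrier G"
  define w where "w = reduced_form g"
  have w: "set w \<subseteq> X \<times> UNIV" "g = word_val G w"
    using g by (simp_all add: w_def reduced_form_reduced reduced_words_letters word_val_reduced_form)
  have "map (apfst \<phi>) w = map (apfst \<psi>) w"
    using w(1) assms(4) by auto
  then show "\<phi> g = \<psi> g"
    using hom_word_val[OF is_group assms(1), of _ w] assms(2,3) letters_carrier[OF w(1)]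
    unfolding w(2) by (metis IntD1)
qed (use assms in auto)

text \<open>This identifies homomorphisms with tuples: a homomorphism is determined by its values on
  the basis, and by the universal property these can be prescribed freely.\<close>

lemma bij_betw_ball_homs:
  assumes "group H"
  shows "bij_betw (\<lambda>\<phi>. restrict \<phi> X) (ball_homs G X H Y p) (X \<rightarrow>\<^sub>E word_ball H Y p)"
  unfolding bij_betw_def
proof (intro conjI equalityI subsetI)
  show "inj_on (\<lambda>\<phi>. restrict \<phi> X) (ball_homs G X H Y p)"
  proof (rule inj_onI)
    fix \<phi> \<psi> assume "\<phi> \<in> ball_homs G X H Y p" "\<psi> \<in> ball_homs G X H Y p"
      and eq: "restrict \<phi> X = restrict \<psi> X"
    moreover have "\<phi> x = \<psi> x" if "x \<in> X" for x
      using fun_cong[OF eq, of x] that by simp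
    ultimately show "\<phi> = \<psi>"
      by (intro hom_eqI[OF assms]) (auto simp: ball_homs_def)
  qed
next
  fix f assume "f \<in> (\<lambda>\<phi>. restrict \<phi> X) ` ball_homs G X H Y p"
  then show "f \<in> X \<rightarrow>\<^sub>E word_ball H Y p"
    by (auto simp: ball_homs_def)
next
  fix f assume f: "f \<in> X \<rightarrow>\<^sub>E word_ball H Y p"
  then have "f \<in> X \<rightarrow> carrier H"
    by (auto simp: word_ball_def PiE_iff)
  from hom_extension[OF assms this] obtain \<phi> where
    \<phi>: "\<phi> \<in> hom G H" "\<phi> \<in> extensional (carrier G)" "\<And>x. x \<in> X \<Longrightarrow> \<phi> x = f x"
    by blast
  then have "\<phi> \<in> ball_homs G X H Y p"
    using f by (auto simp: ball_homs_def PiE_iff)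
  moreover have "f = restrict \<phi> X"
    by (rule extensionalityI[of _ X]) (use f \<phi> in \<open>auto simp: PiE_iff\<close>)
  ultimately show "f \<in> (\<lambda>\<phi>. restrict \<phi> X) ` ball_homs G X H Y p"
    by blast
qed

end


section \<open>Growth of word balls\<close>

context free_group
begin

lemma bij_betw_word_ball:
  "bij_betw (word_val G) {w \<in> reduced_words X. length w \<le> p} (word_ball G X p)"
proof (rule bij_betw_subset[OF bij_word_val])
  show "word_val G ` {w \<in> reduced_words X. length w \<le> p} = word_ball G X p"
  proof (intro equalityI subsetI)
    fix g assume g: "g \<in> word_ball G X p"
    then have "g = word_val G (reduced_form g)" "reduced_form g \<in> reduced_words X"
      "length (reduced_form g) \<le> p"
      by (simp_all add: word_ball_def word_length_def reduced_form_reduced word_val_reduced_form)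
    then show "g \<in> word_val G ` {w \<in> reduced_words X. length w \<le> p}"
      by blast
  qed (auto simp: word_ball_def word_length_word_val reduced_letters_carrier word_val_closed)
qed auto

lemma card_word_ball: "card (word_ball G X p) = card {w \<in> reduced_words X. length w \<le> p}"
  using bij_betw_same_card[OF bij_betw_word_ball] by simp

lemma finite_reduced_words_le:
  assumes "finite X"
  shows "finite {w \<in> reduced_words X. length w \<le> p}"
  by (rule finite_subset[OF _ finite_lists_length_le[of "X \<times> UNIV" p]])
     (use assms in \<open>auto simp: mem_reduced_words_iff\<close>)

lemma finite_word_ball: "finite X \<Longrightarrow> finite (word_ball G X p)"
  using bij_betw_finite[OF bij_betw_word_ball] finite_reduced_words_le by blast

lemma word_ball_carrier: "word_ball G X p \<subseteq> carrier G"
  by (auto simp: word_ball_def)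

lemma card_word_ball_pos:
  assumes "finite X"
  shows "card (word_ball G X p) > 0"
proof -
  have "[] \<in> {w \<in> reduced_words X. length w \<le> p}"
    by simp
  then show ?thesis
    unfolding card_word_ball card_gt_0_iff using finite_reduced_words_le[OF assms] by blast
qed

text \<open>A reduced word can be extended on the left by every letter except the inverse of its
  head, hence in at least \<open>2 * 2 - 1 = 3\<close> ways, and the longer word determines both the
  letter and the tail.\<close>

lemma card_word_ball_Suc:
  assumes "finite X" "card X \<ge> 2"
  shows "3 * card (word_ball G X p) \<le> card (word_ball G X (Suc p))"
proof -
  define R where "R q = {w \<in> reduced_words X. length w \<le> q}" for q
  define E where "E w = {s \<in> X \<times> (UNIV :: bool set). w = [] \<or> hd w \<noteq> inv_letter s}" for w
  have fin: "finite (R q)" for q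
    unfolding R_def by (rule finite_reduced_words_le[OF assms(1)])
  have finE: "finite (E w)" for w
    using assms(1) by (auto simp: E_def)
  have "3 \<le> card (E w)" for w
  proof -
    \<comment> \<open>For \<open>w = []\<close> the removed letter comes from the unspecified
      \<open>hd []\<close>; every letter is admissible there, so removing one still gives a lower
      bound.\<close>
    have "3 \<le> card (X \<times> (UNIV :: bool set)) - card {inv_letter (hd w)}"
      using assms by (simp add: card_cartesian_product)
    also have "\<dots> \<le> card (X \<times> (UNIV :: bool set) - {inv_letter (hd w)})"
      by (rule diff_card_le_card_Diff) simp
    also have "\<dots> \<le> card (E w)"
      by (rule card_mono[OF finE]) (auto simp: E_def)
    finally show ?thesis .
  qed
  then have "3 * card (R p) \<le> (\<Sum>w\<in>R p. card (E w))"
    using sum_mono[of "R p" "\<lambda>_. 3" "\<lambda>w. card (E w)"] by simp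
  also have "\<dots> = card (SIGMA w:R p. E w)"
    using fin finE by simp
  also have "\<dots> \<le> card (R (Suc p))"
    by (rule card_inj_on_le[where f = "\<lambda>(w, s). s # w", OF _ _ fin])
       (auto simp: inj_on_def R_def E_def Cons_reduced_iff)
  finally show ?thesis
    by (simp add: card_word_ball R_def)
qed

lemma card_word_ball_add:
  assumes "finite X" "card X \<ge> 2"
  shows "3 ^ k * card (word_ball G X p) \<le> card (word_ball G X (p + k))"
proof (induction k)
  case (Suc k)
  have "3 ^ Suc k * card (word_ball G X p) \<le> 3 * card (word_ball G X (p + k))"
    using Suc by simp
  also have "\<dots> \<le> card (word_ball G X (p + Suc k))"
    using card_word_ball_Suc[OF assms, of "p + k"] by simp
  finally show ?case .
qed simp

lemma card_le_word_ball:
  assumes "finite X" "inj_on h A" "h ` A \<subseteq> {w \<in> reduced_words X. length w \<le> p}"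
  shows "card A \<le> card (word_ball G X p)"
  unfolding card_word_ball by (rule card_inj_on_le[OF assms(2,3) finite_reduced_words_le[OF assms(1)]])


section \<open>Separated tuples\<close>

text \<open>The reduced word of the group element that the letter \<open>(g, b)\<close> stands for,
  so that letters over a tuple can be compared through their prefixes.\<close>

definition signed_form :: "'a \<Rightarrow> bool \<Rightarrow> ('a \<times> bool) list" where
  "signed_form g b = (if b then reduced_form g else inv_word (reduced_form g))"

lemma length_signed_form [simp]: "length (signed_form g b) = word_length G X g"
  by (simp add: signed_form_def word_length_def)

lemma inv_word_signed_form: "inv_word (signed_form g b) = signed_form g (\<not> b)"
  by (simp add: signed_form_def)

lemma signed_form_reduced: "g \<in> carrier G \<Longrightarrow> signed_form g b \<in> reduced_words X"
  by (simp add: signed_form_def reduced_form_reduced inv_word_reduced)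

lemma word_val_signed_form:
  "g \<in> carrier G \<Longrightarrow> word_val G (signed_form g b) = letter_val G (g, b)"
  by (simp add: signed_form_def letter_val_def word_val_inv_word reduced_letters_carrier
      reduced_form_reduced word_val_reduced_form)

lemma signed_form_inject:
  assumes "g \<in> carrier G" "h \<in> carrier G" "signed_form g b = signed_form h b"
  shows "g = h"
  using assms by (metis signed_form_def inv_word_inv_word word_val_reduced_form)

text \<open>For each of the following events, deleting the first \<open>m\<close> letters of the word
  loses no information.\<close>

lemma card_prefix_le:
  assumes "finite X" "m \<le> p"
  shows "card {g \<in> word_ball G X p. m \<le> word_length G X g \<and> take m (signed_form g b) = u}
           \<le> card (word_ball G X (p - m))" (is "card ?A \<le> _")
proof (rule card_le_word_ball[OF assms(1)])
  show "inj_on (\<lambda>g. drop m (signed_form g b)) ?A"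
  proof (rule inj_onI)
    fix g h assume gh: "g \<in> ?A" "h \<in> ?A" "drop m (signed_form g b) = drop m (signed_form h b)"
    then have "signed_form g b = signed_form h b"
      using append_take_drop_id[of m "signed_form g b"] append_take_drop_id[of m "signed_form h b"]
      by simp
    then show "g = h"
      using gh word_ball_carrier by (intro signed_form_inject[of g h b]) auto
  qed
  show "(\<lambda>g. drop m (signed_form g b)) ` ?A \<subseteq> {w \<in> reduced_words X. length w \<le> p - m}"
    by (auto simp: word_ball_def signed_form_reduced drop_reduced)
qed

lemma card_prefix_inverse_le:
  assumes "finite X" "m \<le> p"
  shows "card {g \<in> word_ball G X p. 2 * m \<le> word_length G X g \<and>
                 take m (signed_form g True) = take m (signed_form g False)}
           \<le> card (word_ball G X (p - m))" (is "card ?A \<le> _")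
proof (rule card_le_word_ball[OF assms(1)])
  \<comment> \<open>If a word and its inverse share their first \<open>m\<close> letters, these are
    the inverse of its last \<open>m\<close> letters. Length at least \<open>2 * m\<close> keeps the
    two blocks disjoint, so the end survives the deletion and restores the beginning.\<close>
  have restore: "reduced_form g = inv_word (drop (length w - m) w) @ w"
    if "g \<in> ?A" "w = drop m (reduced_form g)" for g w
  proof -
    define v where "v = reduced_form g"
    have len: "2 * m \<le> length v" and eq: "take m v = take m (inv_word v)"
      using that by (auto simp: v_def word_length_def signed_form_def)
    have "take m (inv_word v) = inv_word (drop (length v - m) v)"
      using len by (simp add: inv_word_def take_rev drop_map)
    also have "drop (length v - m) v = drop (length w - m) w"
      using len that by (simp add: v_def[symmetric])
    finally show ?thesis
      using eq append_take_drop_id[of m v] that by (simp add: v_def)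
  qed
  show "inj_on (\<lambda>g. drop m (reduced_form g)) ?A"
  proof (rule inj_onI)
    fix g h assume gh: "g \<in> ?A" "h \<in> ?A" "drop m (reduced_form g) = drop m (reduced_form h)"
    then have "reduced_form g = reduced_form h"
      using restore[OF gh(1) refl] restore[OF gh(2) refl] by simp
    then show "g = h"
      using gh word_ball_carrier by (intro signed_form_inject[of g h True]) (auto simp: signed_form_def)
  qed
  show "(\<lambda>g. drop m (reduced_form g)) ` ?A \<subseteq> {w \<in> reduced_words X. length w \<le> p - m}"
    by (auto simp: word_ball_def word_length_def reduced_form_reduced drop_reduced)
qed

text \<open>A small cancellation condition. Out of \<open>3 * m\<close> letters a factor can lose
  fewer than \<open>m\<close> at each end, which leaves at least \<open>m\<close>; injectivity over
  signed indices also separates an entry from its own inverse.\<close>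

definition separated :: "nat \<Rightarrow> 'i set \<Rightarrow> ('i \<Rightarrow> 'a) \<Rightarrow> bool" where
  "separated m Z f \<longleftrightarrow>
     (\<forall>z\<in>Z. 3 * m \<le> word_length G X (f z)) \<and>
     inj_on (\<lambda>s. take m (signed_form (f (fst s)) (snd s))) (Z \<times> UNIV)"

text \<open>In a product of the given elements and their inverses, fewer than \<open>m\<close> letters cancel on
  either side of each junction, so the first \<open>2 m\<close> letters of every factor
  survive multiplication by what follows it.\<close>

lemma separated_word:
  assumes sep: "separated m Z f" and f: "f \<in> Z \<rightarrow> carrier G"
    and "w \<in> reduced_words Z" "w \<noteq> []"
  defines "v \<equiv> reduced_form (word_val G (map (apfst f) w))"
  shows "m * length w + m \<le> length v \<and>
         take (2 * m) v = take (2 * m) (signed_form (f (fst (hd w))) (snd (hd w)))"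
  using assms(3,4) unfolding v_def
\<comment> \<open>The surplus \<open>m\<close> pays for the loss of the tail at the next junction,
  while the new factor keeps at least \<open>2 * m\<close> letters and so restores the surplus. The
  prefix is carried along because the next cancellation is compared with it.\<close>
proof (induction w)
  case (Cons s w)
  define v where "v = signed_form (f (fst s)) (snd s)"
  have s: "s \<in> Z \<times> UNIV" and w: "w \<in> reduced_words Z"
    using Cons.prems by (auto simp: Cons_reduced_iff)
  have fs: "f (fst s) \<in> carrier G"
    using s f by auto
  have v: "v \<in> reduced_words X" "letter_val G (apfst f s) = word_val G v"
    using fs by (simp_all add: v_def signed_form_reduced word_val_signed_form apfst_def map_prod_def split_beta)
  have len_v: "3 * m \<le> length v"
    using sep s by (auto simp: separated_def v_def)
  show ?case
  proof (cases "w = []")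
    case True
    then have "reduced_form (word_val G (map (apfst f) (s # w))) = v"
      using v reduced_letters_carrier[OF v(1)] by (simp add: word_val_Cons reduced_form_word_val word_val_closed)
    then show ?thesis
      using len_v True by (simp add: v_def)
  next
    case False
    define x where "x = word_val G (map (apfst f) w)"
    define u where "u = reduced_form x"
    have "set (map (apfst f) w) \<subseteq> carrier G \<times> UNIV"
      by (rule set_map_apfst_subset[OF f reduced_words_letters[OF w]])
    then have "x \<in> carrier G"
      unfolding x_def by (rule word_val_closed)
    then have u: "u \<in> reduced_words X" "word_val G u = x"
      by (simp_all add: u_def reduced_form_reduced word_val_reduced_form)
    have IH: "m * length w + m \<le> length u"
        "take (2 * m) u = take (2 * m) (signed_form (f (fst (hd w))) (snd (hd w)))"
      using Cons.IH[OF w False] by (simp_all add: u_def x_def)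
    \<comment> \<open>The common prefix \<open>a\<close> of the inverse of \<open>v\<close> and of
      \<open>u\<close> is exactly what cancels in the product of \<open>v\<close> and
      \<open>u\<close>, leaving \<open>inv_word b @ c\<close>.\<close>
    obtain a b c where abc: "inv_word v = a @ b" "u = a @ c" "b = [] \<or> c = [] \<or> hd b \<noteq> hd c"
      using longest_common_prefix[of "inv_word v" u] by blast
    have v_eq: "v = inv_word b @ inv_word a"
      using arg_cong[OF abc(1), of inv_word] by simp
    \<comment> \<open>Agreement in \<open>m\<close> letters would make the inverse of
      \<open>s\<close> and the next letter share a prefix; injectivity then gives
      \<open>hd w = inv_letter s\<close>, against reducedness.\<close>
    have len_a: "length a < m"
    proof (rule ccontr)
      assume "\<not> length a < m"
      then have "take m (inv_word v) = take m u"
        by (simp add: abc(1,2))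
      also have "\<dots> = take m (take (2 * m) u)"
        by simp
      also have "\<dots> = take m (signed_form (f (fst (hd w))) (snd (hd w)))"
        by (simp add: IH(2))
      finally have "take m (signed_form (f (fst (inv_letter s))) (snd (inv_letter s)))
          = take m (signed_form (f (fst (hd w))) (snd (hd w)))"
        by (simp add: v_def inv_word_signed_form inv_letter_def)
      moreover have "hd w \<in> Z \<times> UNIV"
        using reduced_words_letters[OF w] hd_in_set[OF False] by blast
      moreover have "inv_letter s \<in> Z \<times> UNIV" "inv_letter s \<noteq> hd w"
        using s Cons.prems False by (auto simp: Cons_reduced_iff)
      ultimately show False
        using sep inj_onD[of _ "Z \<times> UNIV" "inv_letter s" "hd w"] unfolding separated_def by metis
    qed
    \<comment> \<open>If both are nonempty, \<open>b\<close> and \<open>c\<close> start differently,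
      so nothing further cancels at the junction.\<close>
    have red: "inv_word b @ c \<in> reduced_words X"
    proof (cases b)
      case (Cons t b')
      then have "inv_letter (last (inv_word b)) = hd b"
        by simp
      then show ?thesis
        using v(1) u(1) abc(3) Cons unfolding v_eq abc(2) append_reduced_iff by (metis list.distinct(1))
    qed (use u(1) in \<open>simp add: abc(2) append_reduced_iff\<close>)
    have car: "set (inv_word b) \<subseteq> carrier G \<times> UNIV" "set a \<subseteq> carrier G \<times> UNIV"
        "set c \<subseteq> carrier G \<times> UNIV" "set (inv_word a) \<subseteq> carrier G \<times> UNIV"
      using reduced_letters_carrier[OF v(1)] reduced_letters_carrier[OF u(1)]
      by (auto simp: v_eq abc(2))
    have "word_val G (map (apfst f) (s # w)) = word_val G v \<otimes> word_val G u"
      by (simp add: word_val_Cons v(2) u(2) x_def)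
    also have "\<dots> = word_val G (inv_word b @ c)"
      using car by (simp add: v_eq abc(2) word_val_append word_val_inv_word[of a] word_val_closed
          m_assoc inv_solve_left')
    finally have eq: "reduced_form (word_val G (map (apfst f) (s # w))) = inv_word b @ c"
      using reduced_form_word_val[OF red] by simp
    have "length v = length b + length a" "length u = length a + length c"
      by (simp_all add: v_eq abc(2))
    then have "m * length (s # w) + m \<le> length (inv_word b @ c)"
        "take (2 * m) (inv_word b @ c) = take (2 * m) v"
      using len_v len_a IH(1) by (simp_all add: v_eq)
    then show ?thesis
      by (simp only: eq v_def list.sel)
  qed
qed simp

end

text \<open>Once the other coordinates are fixed, at most \<open>M\<close> values remain for
  \<open>f z\<close>; the condition \<open>Q\<close> on it may refer to those other coordinates
  because \<open>M\<close> is uniform.\<close>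

lemma card_PiE_fibre_le:
  assumes "finite Z" "z \<in> Z" "finite B"
    and M: "\<And>g. card {b \<in> B. Q g b} \<le> M"
  shows "card {f \<in> Z \<rightarrow>\<^sub>E B. Q (restrict f (Z - {z})) (f z)} \<le> M * card B ^ (card Z - 1)"
proof -
  define P where "P = (Z - {z}) \<rightarrow>\<^sub>E B"
  have fin: "finite P"
    using assms by (auto simp: P_def intro: finite_PiE)
  have "card {f \<in> Z \<rightarrow>\<^sub>E B. Q (restrict f (Z - {z})) (f z)} \<le> card (SIGMA g:P. {b \<in> B. Q g b})"
  proof (rule card_inj_on_le[where f = "\<lambda>f. (restrict f (Z - {z}), f z)"])
    show "inj_on (\<lambda>f. (restrict f (Z - {z}), f z)) {f \<in> Z \<rightarrow>\<^sub>E B. Q (restrict f (Z - {z})) (f z)}"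
    proof (rule inj_onI)
      fix f g assume fg: "f \<in> {f \<in> Z \<rightarrow>\<^sub>E B. Q (restrict f (Z - {z})) (f z)}"
        "g \<in> {f \<in> Z \<rightarrow>\<^sub>E B. Q (restrict f (Z - {z})) (f z)}"
        "(restrict f (Z - {z}), f z) = (restrict g (Z - {z}), g z)"
      show "f = g"
      proof (rule extensionalityI[of _ Z])
        fix x assume "x \<in> Z"
        then show "f x = g x"
          using fg(3) by (cases "x = z") (auto dest: fun_cong[where x = x])
      qed (use fg in \<open>auto simp: PiE_iff\<close>)
    qed
    show "finite (SIGMA g:P. {b \<in> B. Q g b})"
      using fin assms(3) by auto
    show "(\<lambda>f. (restrict f (Z - {z}), f z)) ` {f \<in> Z \<rightarrow>\<^sub>E B. Q (restrict f (Z - {z})) (f z)}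
        \<subseteq> (SIGMA g:P. {b \<in> B. Q g b})"
    proof (rule image_subsetI)
      fix f assume "f \<in> {f \<in> Z \<rightarrow>\<^sub>E B. Q (restrict f (Z - {z})) (f z)}"
      then have f: "f \<in> Z \<rightarrow>\<^sub>E B" and Q: "Q (restrict f (Z - {z})) (f z)"
        by simp_all
      have "restrict f (Z - {z}) \<in> P"
        unfolding P_def by (rule restrict_PiE_iff[THEN iffD2]) (use f in auto)
      moreover have "f z \<in> B"
        using f assms(2) by auto
      ultimately show "(restrict f (Z - {z}), f z) \<in> (SIGMA g:P. {b \<in> B. Q g b})"
        using Q by blast
    qed
  qed
  also have "\<dots> = (\<Sum>g\<in>P. card {b \<in> B. Q g b})"
    using fin assms(3) by simp
  also have "\<dots> \<le> card P * M"
    using sum_bounded_above[of P "\<lambda>g. card {b \<in> B. Q g b}" M] M by simp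
  also have "card P = card B ^ (card Z - 1)"
    using assms by (simp add: P_def card_funcsetE)
  finally show ?thesis
    by (simp only: mult.commute)
qed


section \<open>Targets of rank greater than one\<close>

lemma card_Un_UN_le:
  assumes "finite I" "finite J" "\<And>i. i \<in> I \<Longrightarrow> card (E i) \<le> K" "\<And>j. j \<in> J \<Longrightarrow> card (D j) \<le> K"
  shows "card ((\<Union>i\<in>I. E i) \<union> (\<Union>j\<in>J. D j)) \<le> (card I + card J) * K"
proof -
  have "card ((\<Union>i\<in>I. E i) \<union> (\<Union>j\<in>J. D j)) \<le> card (\<Union>i\<in>I. E i) + card (\<Union>j\<in>J. D j)"
    by (rule card_Un_le)
  also have "\<dots> \<le> (\<Sum>i\<in>I. card (E i)) + (\<Sum>j\<in>J. card (D j))"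
    by (intro add_mono card_UN_le assms)
  also have "\<dots> \<le> card I * K + card J * K"
    using sum_bounded_above[of I "\<lambda>i. card (E i)" K] sum_bounded_above[of J "\<lambda>j. card (D j)" K] assms
    by (intro add_mono) auto
  finally show ?thesis
    by (simp add: algebra_simps)
qed

context free_group
begin

text \<open>Separation fails through a short entry, one event for each index, or through a
  coincidence of prefixes, one event for each ordered pair of signed indices. Each event leaves one
  coordinate at most as many values as the ball of radius \<open>p - m\<close> has elements.\<close>

lemma card_not_separated_le:
  assumes "finite X" "finite Z" "4 * m \<le> p"
  shows "card {f \<in> Z \<rightarrow>\<^sub>E word_ball G X p. \<not> separated m Z f}
           \<le> (card Z + (2 * card Z)\<^sup>2) *
              (card (word_ball G X (p - m)) * card (word_ball G X p) ^ (card Z - 1))"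
proof -
  define N where "N = card (word_ball G X (p - m))"
  define B where "B = word_ball G X p"
  define K where "K = N * card B ^ (card Z - 1)"
  define E where "E z = {f \<in> Z \<rightarrow>\<^sub>E B. word_length G X (f z) < 3 * m}" for z :: 'c
  define D where "D st = {f \<in> Z \<rightarrow>\<^sub>E B. fst st \<noteq> snd st \<and> 3 * m \<le> word_length G X (f (fst (fst st))) \<and>
     take m (signed_form (f (fst (fst st))) (snd (fst st))) =
     take m (signed_form (f (fst (snd st))) (snd (snd st)))}" for st :: "('c \<times> bool) \<times> ('c \<times> bool)"
  have finB: "finite B"
    unfolding B_def by (rule finite_word_ball[OF assms(1)])
  have fin: "finite {f \<in> Z \<rightarrow>\<^sub>E B. P f}" for P
    using finite_PiE[OF assms(2), of "\<lambda>_. B"] finB by simp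
  have E_le: "card (E z) \<le> K" if z: "z \<in> Z" for z
  proof -
    \<comment> \<open>By \<open>4 * m \<le> p\<close> the short elements already lie in the ball of
      radius \<open>p - m\<close>.\<close>
    have "card {g \<in> B. word_length G X g < 3 * m} \<le> N"
      unfolding N_def
      by (rule card_mono[OF finite_word_ball[OF assms(1)]]) (use assms(3) in \<open>auto simp: B_def word_ball_def\<close>)
    from card_PiE_fibre_le[OF assms(2) z finB, of "\<lambda>_ g. word_length G X g < 3 * m", OF this]
    show ?thesis
      by (simp add: E_def K_def)
  qed
  have D_le: "card (D st) \<le> K" if st: "st \<in> (Z \<times> UNIV) \<times> (Z \<times> UNIV)" for st
  proof -
    obtain x b y c where st_eq: "st = ((x, b), (y, c))"
      by (metis surj_pair)
    then have xy: "x \<in> Z" "y \<in> Z"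
      using st by simp_all
    show ?thesis
    proof (cases "y = x")
      \<comment> \<open>Distinct letters on one index have opposite signs, so here an entry shares
        its prefix with its own inverse.\<close>
      case True
      have "card {g \<in> B. 2 * m \<le> word_length G X g \<and>
              take m (signed_form g True) = take m (signed_form g False)} \<le> N"
        unfolding N_def B_def using assms by (intro card_prefix_inverse_le) auto
      from card_PiE_fibre_le[OF assms(2) xy(1) finB, of "\<lambda>_ g. 2 * m \<le> word_length G X g \<and>
              take m (signed_form g True) = take m (signed_form g False)", OF this]
      have "card {f \<in> Z \<rightarrow>\<^sub>E B. 2 * m \<le> word_length G X (f x) \<and>
              take m (signed_form (f x) True) = take m (signed_form (f x) False)} \<le> K"
        by (simp add: K_def)
      moreover have "D st \<subseteq> {f \<in> Z \<rightarrow>\<^sub>E B. 2 * m \<le> word_length G X (f x) \<and>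
              take m (signed_form (f x) True) = take m (signed_form (f x) False)}"
      proof
        fix f assume "f \<in> D st"
        then show "f \<in> {f \<in> Z \<rightarrow>\<^sub>E B. 2 * m \<le> word_length G X (f x) \<and>
            take m (signed_form (f x) True) = take m (signed_form (f x) False)}"
          using True by (cases b; cases c) (simp_all add: D_def st_eq)
      qed
      ultimately show ?thesis
        by (rule order_trans[OF card_mono[OF fin], rotated])
    next
      case False
      \<comment> \<open>The entry at \<open>y\<close> belongs to the fixed coordinates, so it
        prescribes the first \<open>m\<close> letters of the entry at \<open>x\<close> or of its
        inverse.\<close>
      define Q where "Q g h \<longleftrightarrow> m \<le> word_length G X h \<and>
              take m (signed_form h b) = take m (signed_form (g y) c)" for g h
      have "card {h \<in> B. Q g h} \<le> N" for g
        unfolding N_def B_def Q_def using assms by (intro card_prefix_le) auto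
      from card_PiE_fibre_le[OF assms(2) xy(1) finB, of Q, OF this]
      have "card {f \<in> Z \<rightarrow>\<^sub>E B. Q (restrict f (Z - {x})) (f x)} \<le> K"
        by (simp add: K_def)
      moreover have "D st \<subseteq> {f \<in> Z \<rightarrow>\<^sub>E B. Q (restrict f (Z - {x})) (f x)}"
        using False xy by (auto simp: D_def st_eq Q_def)
      ultimately show ?thesis
        by (rule order_trans[OF card_mono[OF fin], rotated])
    qed
  qed
  have "{f \<in> Z \<rightarrow>\<^sub>E B. \<not> separated m Z f} \<subseteq> (\<Union>z\<in>Z. E z) \<union> (\<Union>st\<in>(Z \<times> UNIV) \<times> (Z \<times> UNIV). D st)"
  proof
    fix f assume f: "f \<in> {f \<in> Z \<rightarrow>\<^sub>E B. \<not> separated m Z f}"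
    show "f \<in> (\<Union>z\<in>Z. E z) \<union> (\<Union>st\<in>(Z \<times> UNIV) \<times> (Z \<times> UNIV). D st)"
    proof (cases "\<exists>z\<in>Z. word_length G X (f z) < 3 * m")
      case False
      then have long: "\<forall>z\<in>Z. 3 * m \<le> word_length G X (f z)"
        by auto
      then obtain s t where st: "s \<in> Z \<times> UNIV" "t \<in> Z \<times> UNIV" "s \<noteq> t"
        "take m (signed_form (f (fst s)) (snd s)) = take m (signed_form (f (fst t)) (snd t))"
        using f unfolding separated_def inj_on_def by blast
      then have "f \<in> D (s, t)"
        using f long by (auto simp: D_def)
      then show ?thesis
        using st(1,2) by blast
    qed (use f in \<open>auto simp: E_def\<close>)
  qed
  moreover have "finite ((\<Union>z\<in>Z. E z) \<union> (\<Union>st\<in>(Z \<times> UNIV) \<times> (Z \<times> UNIV). D st))"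
    unfolding E_def D_def by (intro finite_UnI finite_UN_I finite_cartesian_product assms(2) fin) auto
  ultimately have "card {f \<in> Z \<rightarrow>\<^sub>E B. \<not> separated m Z f}
      \<le> card ((\<Union>z\<in>Z. E z) \<union> (\<Union>st\<in>(Z \<times> UNIV) \<times> (Z \<times> UNIV). D st))"
    by (rule card_mono[rotated])
  also have "\<dots> \<le> (card Z + card ((Z \<times> (UNIV :: bool set)) \<times> (Z \<times> (UNIV :: bool set)))) * K"
    using assms(2) by (intro card_Un_UN_le E_le D_le) auto
  finally show ?thesis
    by (simp add: K_def N_def B_def card_cartesian_product power2_eq_square mult_ac)
qed

section \<open>Density zero for images of separated tuples\<close>

lemma sum_power_le_Suc_power: "(\<Sum>i\<le>n. a ^ i) \<le> (Suc a) ^ n" for a n :: nat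
proof (induction n)
  case (Suc n)
  have "a * a ^ n \<le> a * Suc a ^ n"
    by (intro mult_left_mono power_mono) auto
  with Suc have "(\<Sum>i\<le>n. a ^ i) + a * a ^ n \<le> Suc a ^ n + a * Suc a ^ n"
    by (rule add_mono)
  then show ?case
    by simp
qed simp

text \<open>The growth rates differ: elements of the image of length at most \<open>q\<close> come
  from words of at most \<open>q div m\<close> letters, and the lower bound on \<open>2 ^ m\<close>
  limits their number to \<open>2 ^ q\<close>.\<close>

lemma density_seq_separated:
  assumes fin: "finite X" "finite Z" and rank: "card X \<ge> 2"
    and sep: "separated m Z f" and f: "f \<in> Z \<rightarrow> carrier G"
    and m: "m > 0" "2 * card Z + 1 \<le> 2 ^ m"
  shows "density_seq G X ((\<lambda>w. word_val G (map (apfst f) w)) ` reduced_words Z) \<longlonglongrightarrow> 0"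
proof -
  define val where "val w = word_val G (map (apfst f) w)" for w
  define S where "S = val ` reduced_words Z"
  have card_le: "card (S \<inter> word_ball G X q) \<le> 2 ^ q" for q
  proof -
    define W where "W = {w. set w \<subseteq> Z \<times> (UNIV :: bool set) \<and> length w \<le> q div m}"
    have "S \<inter> word_ball G X q \<subseteq> val ` W"
    proof
      fix g assume "g \<in> S \<inter> word_ball G X q"
      then obtain w where w: "w \<in> reduced_words Z" "g = val w" "length (reduced_form g) \<le> q"
        by (auto simp: S_def word_ball_def word_length_def)
      have "m * length w \<le> q"
        using separated_word[OF sep f w(1)] w(2,3) by (cases "w = []") (auto simp: val_def)
      then have "length w \<le> q div m"
        using m(1) by (simp add: less_eq_div_iff_mult_less_eq mult.commute)
      then show "g \<in> val ` W"
        using w reduced_words_letters[OF w(1)] by (auto simp: W_def)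
    qed
    moreover have "finite W"
      unfolding W_def using fin by (intro finite_lists_length_le) auto
    ultimately have "card (S \<inter> word_ball G X q) \<le> card W"
      by (meson card_image_le card_mono finite_imageI le_trans)
    also have "card W = (\<Sum>i\<le>q div m. (2 * card Z) ^ i)"
      unfolding W_def using fin by (subst card_lists_length_le) (auto simp: card_cartesian_product mult.commute)
    also have "\<dots> \<le> (2 * card Z + 1) ^ (q div m)"
      using sum_power_le_Suc_power[of "2 * card Z" "q div m"] by simp
    also have "\<dots> \<le> (2 ^ m) ^ (q div m)"
      using m(2) by (rule power_mono) simp
    also have "\<dots> \<le> 2 ^ q"
      by (simp flip: power_mult)
    finally show ?thesis .
  qed
  have "density_seq G X S q \<le> (2 / 3) ^ q" for q
  proof -
    have "3 ^ q \<le> 3 ^ q * card (word_ball G X 0)"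
      using card_word_ball_pos[OF fin(1), of 0] by simp
    also have "\<dots> \<le> card (word_ball G X q)"
      using card_word_ball_add[OF fin(1) rank, of q 0] by simp
    finally have "real (3 ^ q) \<le> real (card (word_ball G X q))"
      by (rule of_nat_mono)
    moreover have "real (card (S \<inter> word_ball G X q)) \<le> real (2 ^ q)"
      using card_le by (rule of_nat_mono)
    ultimately show ?thesis
      unfolding density_seq_def power_divide by (intro frac_le) auto
  qed
  moreover have "(\<lambda>q. (2 / 3 :: real) ^ q) \<longlonglongrightarrow> 0"
    by (rule LIMSEQ_power_zero) simp
  ultimately have "density_seq G X S \<longlonglongrightarrow> 0"
    by (intro tendsto_sandwich[of "\<lambda>_. 0" "density_seq G X S" sequentially "\<lambda>q. (2 / 3) ^ q"]
          always_eventually allI tendsto_const) (simp_all add: density_seq_def)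
  then show ?thesis
    by (simp add: S_def val_def)
qed

text \<open>Exceptional tuples will only be counted, so their density must be bounded whether it is
  a limit or a value of \<open>c\<close>.\<close>

lemma density_bounds:
  assumes "finite X" "0 \<le> c S \<and> c S \<le> 1"
  shows "0 \<le> density G X c S \<and> density G X c S \<le> 1"
proof (cases "convergent (density_seq G X S)")
  case True
  then have lim: "density_seq G X S \<longlonglongrightarrow> density G X c S"
    by (simp add: density_def convergent_LIMSEQ_iff)
  have "card (S \<inter> word_ball G X p) \<le> card (word_ball G X p)" for p
    by (rule card_mono[OF finite_word_ball[OF assms(1)]]) auto
  then have "density_seq G X S p \<le> 1" for p
    using card_word_ball_pos[OF assms(1), of p] by (simp add: density_seq_def)
  moreover have "density_seq G X S p \<ge> 0" for p
    by (simp add: density_seq_def)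
  ultimately show ?thesis
    using LIMSEQ_le_const[OF lim] LIMSEQ_le_const2[OF lim] by blast
qed (use assms in \<open>simp add: density_def\<close>)

lemma density_eqI: "density_seq G X S \<longlonglongrightarrow> d \<Longrightarrow> density G X c S = d"
  by (simp add: density_def limI convergentI)

section \<open>Means over homomorphisms as means over tuples\<close>

lemma image_hom_eq:
  assumes "group K" "\<phi> \<in> hom G K"
  shows "\<phi> ` carrier G = (\<lambda>w. word_val K (map (apfst (restrict \<phi> X)) w)) ` reduced_words X"
proof -
  have "carrier G = word_val G ` reduced_words X"
    using bij_word_val by (simp add: bij_betw_def)
  moreover have "\<phi> (word_val G w) = word_val K (map (apfst (restrict \<phi> X)) w)"
    if "w \<in> reduced_words X" for w
  proof -
    have "map (apfst (restrict \<phi> X)) w = map (apfst \<phi>) w"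
      using reduced_words_letters[OF that] by (intro map_cong) auto
    then show ?thesis
      using hom_word_val[OF is_group assms reduced_letters_carrier[OF that]] by (rule ssubst)
  qed
  ultimately show ?thesis
    by (simp add: image_image cong: image_cong)
qed

text \<open>The image depends only on the restriction to the basis, so the bijection with tuples
  reindexes the sum.\<close>

lemma mean_density_eq:
  assumes "group H"
  shows "mean_density G X H Y c p = (\<Sum>f \<in> X \<rightarrow>\<^sub>E word_ball H Y p.
           density H Y c ((\<lambda>w. word_val H (map (apfst f) w)) ` reduced_words X)) /
           real (card (word_ball H Y p)) ^ card X"
proof -
  have "(\<Sum>\<phi> \<in> ball_homs G X H Y p. density H Y c (\<phi> ` carrier G))
      = (\<Sum>\<phi> \<in> ball_homs G X H Y p.
          density H Y c ((\<lambda>w. word_val H (map (apfst (restrict \<phi> X)) w)) ` reduced_words X))"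
    by (intro sum.cong refl) (simp add: image_hom_eq[OF assms] ball_homs_def)
  also have "\<dots> = (\<Sum>f \<in> X \<rightarrow>\<^sub>E word_ball H Y p.
          density H Y c ((\<lambda>w. word_val H (map (apfst f) w)) ` reduced_words X))"
    by (rule sum.reindex_bij_betw[OF bij_betw_ball_homs[OF assms]])
  finally show ?thesis
    by (simp add: mean_density_def)
qed

end

lemma expected_density_rank_gt_1:
  assumes "free_group G X" "finite X" "free_group H Y" "finite Y" "card Y \<ge> 2"
    and c: "\<And>S. 0 \<le> c S \<and> c S \<le> 1"
  shows "mean_density G X H Y c \<longlonglongrightarrow> 0"
proof -
  interpret G: free_group G X by fact
  interpret H: free_group H Y by fact
  define r where "r = card X"
  define K where "K = real (r + (2 * r)\<^sup>2)"
  define N where "N p = card (word_ball H Y p)" for p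
  define \<delta> where
    "\<delta> f = density H Y c ((\<lambda>w. word_val H (map (apfst f) w)) ` reduced_words X)" for f
  have mean: "mean_density G X H Y c p = (\<Sum>f \<in> X \<rightarrow>\<^sub>E word_ball H Y p. \<delta> f) / real (N p) ^ r" for p
    unfolding \<delta>_def N_def r_def by (rule G.mean_density_eq[OF H.is_group])
  have \<delta>_bounds: "0 \<le> \<delta> f" "\<delta> f \<le> 1" for f
    using H.density_bounds[OF assms(4) c] by (auto simp: \<delta>_def)
  have N_pos: "N p > 0" for p
    unfolding N_def by (rule H.card_word_ball_pos[OF assms(4)])
  have "mean_density G X H Y c p \<le> K * (1 / 3) ^ (p div 4)"
    if m: "p div 4 > 0" "2 * r + 1 \<le> 2 ^ (p div 4)" for p
  proof -
    \<comment> \<open>The largest \<open>m\<close> with \<open>4 * m \<le> p\<close>, as the count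
      of tuples that are not separated requires.\<close>
    define m where "m = p div 4"
    define B where "B = word_ball H Y p"
    have fin: "finite (X \<rightarrow>\<^sub>E B)"
      unfolding B_def using assms by (intro finite_PiE H.finite_word_ball) auto
    have zero: "\<delta> f = 0" if "f \<in> X \<rightarrow>\<^sub>E B" "H.separated m X f" for f
      unfolding \<delta>_def
    proof (rule H.density_eqI, rule H.density_seq_separated[OF assms(4,2,5) that(2)])
      show "f \<in> X \<rightarrow> carrier H"
        using that(1) H.word_ball_carrier by (auto simp: B_def PiE_iff)
    qed (use m in \<open>simp_all add: m_def r_def\<close>)
    have "(\<Sum>f \<in> X \<rightarrow>\<^sub>E B. \<delta> f) = (\<Sum>f \<in> {f \<in> X \<rightarrow>\<^sub>E B. \<not> H.separated m X f}. \<delta> f)"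
      by (rule sum.mono_neutral_right[OF fin]) (auto simp: zero)
    also have "\<dots> \<le> real (card {f \<in> X \<rightarrow>\<^sub>E B. \<not> H.separated m X f})"
      using sum_bounded_above[of "{f \<in> X \<rightarrow>\<^sub>E B. \<not> H.separated m X f}" \<delta> 1] \<delta>_bounds by simp
    also have "\<dots> \<le> K * (real (N (p - m)) * real (N p) ^ (r - 1))"
      using of_nat_mono[OF H.card_not_separated_le[OF assms(4,2), of m p], where ?'a = real]
      by (simp add: B_def K_def N_def r_def m_def)
    finally have sum_le: "(\<Sum>f \<in> X \<rightarrow>\<^sub>E B. \<delta> f) \<le> K * (real (N (p - m)) * real (N p) ^ (r - 1))" .
    have "real (3 ^ m * N (p - m)) \<le> real (N p)"
      using H.card_word_ball_add[OF assms(4,5), of m "p - m"]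
      unfolding N_def by (intro of_nat_mono) (simp add: m_def)
    then have N_le: "real (N (p - m)) \<le> (1 / 3) ^ m * real (N p)"
      by (simp add: field_simps power_divide)
    have "(\<Sum>f \<in> X \<rightarrow>\<^sub>E B. \<delta> f) \<le> K * ((1 / 3) ^ m * real (N p) ^ r)"
    \<comment> \<open>For \<open>r = 0\<close> truncated subtraction makes \<open>r - 1 = 0\<close>,
      and the estimate survives because \<open>K = 0\<close>.\<close>
    proof (cases "r = 0")
      case True
      then show ?thesis using sum_le by (simp add: K_def)
    next
      case False
      have "real (N (p - m)) * real (N p) ^ (r - 1) \<le> ((1 / 3) ^ m * real (N p)) * real (N p) ^ (r - 1)"
        by (intro mult_right_mono N_le) simp
      also have "\<dots> = (1 / 3) ^ m * real (N p) ^ r"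
        using False by (cases r) auto
      finally have "K * (real (N (p - m)) * real (N p) ^ (r - 1)) \<le> K * ((1 / 3) ^ m * real (N p) ^ r)"
        by (intro mult_left_mono) (auto simp: K_def)
      with sum_le show ?thesis by linarith
    qed
    then show ?thesis
      unfolding mean using N_pos[of p] by (simp add: m_def B_def divide_le_eq mult_ac)
  qed
  moreover have "eventually (\<lambda>p. p div 4 > (0 :: nat)) sequentially"
    using eventually_ge_at_top[of 4] by eventually_elim auto
  moreover have "eventually (\<lambda>p. 2 * r + 1 \<le> 2 ^ (p div 4)) sequentially"
    using eventually_ge_at_top[of "4 * (2 * r + 1)"]
  proof eventually_elim
    case (elim p)
    then have "2 * r + 1 \<le> p div 4"
      by (simp add: less_eq_div_iff_mult_less_eq)
    also have "\<dots> \<le> 2 ^ (p div 4)"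
      by (rule less_imp_le[OF less_exp])
    finally show ?case .
  qed
  ultimately have upper: "eventually (\<lambda>p. mean_density G X H Y c p \<le> K * (1 / 3) ^ (p div 4)) sequentially"
    by (auto elim: eventually_elim2)
  have lower: "mean_density G X H Y c p \<ge> 0" for p
    unfolding mean by (intro divide_nonneg_nonneg sum_nonneg \<delta>_bounds) auto
  have "filterlim (\<lambda>p. p div 4) sequentially (sequentially :: nat filter)"
    by (intro filterlim_at_top_div_const_nat) simp
  from filterlim_compose[OF LIMSEQ_power_zero[of "1 / 3 :: real"] this]
  have "(\<lambda>p. K * (1 / 3) ^ (p div 4)) \<longlonglongrightarrow> 0"
    using tendsto_mult_right_zero by auto
  then show ?thesis
    by (intro tendsto_sandwich[OF always_eventually upper tendsto_const] allI lower)
qed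


section \<open>Moebius inversion\<close>

definition moebius :: "nat \<Rightarrow> int" where
  "moebius n = (if squarefree n then (- 1) ^ card (prime_factors n) else 0)"

lemma moebius_1 [simp]: "moebius (Suc 0) = 1"
  by (simp add: moebius_def)

lemma abs_moebius_le: "\<bar>moebius n\<bar> \<le> 1"
  by (simp add: moebius_def)

lemma moebius_prime_mult:
  assumes "prime p" "\<not> p dvd d" "squarefree d"
  shows "moebius (p * d) = - moebius d"
proof -
  have "coprime p d"
    using assms prime_imp_coprime by blast
  then have "squarefree (p * d)"
    using assms by (intro squarefree_mult_coprime squarefree_prime[of p] \<open>coprime p d\<close>)
  moreover have "prime_factors (p * d) = insert p (prime_factors d)"
    using assms by (subst prime_factors_product) (auto simp: prime_prime_factors prime_gt_0_nat intro: Nat.gr0I)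
  moreover have "p \<notin> prime_factors d"
    using assms by (auto dest: in_prime_factors_imp_dvd)
  ultimately show ?thesis
    using assms by (simp add: moebius_def)
qed

text \<open>The squarefree divisors cancel in pairs \<open>d\<close>, \<open>p d\<close> for any prime \<open>p\<close> dividing \<open>n\<close>.\<close>

lemma sum_moebius_divisors:
  assumes "n > 1"
  shows "(\<Sum>d | d dvd n. moebius d) = 0"
proof -
  obtain p where p: "prime p" "p dvd n"
    using assms prime_factor_nat[of n] by auto
  define A where "A = {d. d dvd n \<and> squarefree d \<and> \<not> p dvd d}"
  define B where "B = {d. d dvd n \<and> squarefree d \<and> p dvd d}"
  have fin: "finite {d. d dvd n}"
    using assms by (intro finite_divisors_nat) auto
  have "(\<Sum>d | d dvd n. moebius d) = (\<Sum>d \<in> A \<union> B. moebius d)"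
    using fin by (intro sum.mono_neutral_right) (auto simp: A_def B_def moebius_def)
  also have "\<dots> = sum moebius A + sum moebius B"
    by (intro sum.union_disjoint finite_subset[OF _ fin]) (auto simp: A_def B_def)
  also have "sum moebius B = (\<Sum>d\<in>A. moebius (p * d))"
  proof (rule sum.reindex_bij_betw[symmetric], rule bij_betwI')
    fix d e show "(p * d = p * e) = (d = e)" using p(1) by (auto dest: prime_gt_0_nat)
  next
    fix d assume d: "d \<in> A"
    then have "coprime p d"
      using p(1) prime_imp_coprime unfolding A_def by blast
    then show "p * d \<in> B"
      using d p by (auto simp: A_def B_def intro: divides_mult squarefree_mult_coprime squarefree_prime)
  next
    fix e assume "e \<in> B"
    then obtain d where d: "e = p * d" "e dvd n" "squarefree e"
      by (auto simp: B_def)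
    \<comment> \<open>Squarefreeness forbids a second factor \<open>p\<close>, so division by
      \<open>p\<close> maps \<open>B\<close> back to \<open>A\<close>.\<close>
    have "\<not> p dvd d"
    proof
      assume "p dvd d"
      then have "p ^ 2 dvd e"
        by (simp add: d power2_eq_square)
      then show False
        using d p(1) by (auto dest!: squarefreeD)
    qed
    moreover have "squarefree d" "d dvd n"
      using d by (auto dest: squarefree_multD dvd_mult_right)
    ultimately show "\<exists>d\<in>A. e = p * d"
      using d by (auto simp: A_def)
  qed
  also have "\<dots> = - sum moebius A"
    using p(1) by (simp add: A_def moebius_prime_mult flip: sum_negf)
  finally show ?thesis by simp
qed

text \<open>Nested floors combine, \<open>q div d div g = q div (d * g)\<close>. Grouping the pairs
  by \<open>m = d * g\<close> gives \<open>P (q div m)\<close> as coefficient the sum of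
  \<open>moebius\<close> over the divisors of \<open>m\<close>, which vanishes unless
  \<open>m = 1\<close>.\<close>

lemma moebius_inversion_floor:
  fixes P :: "nat \<Rightarrow> real"
  assumes P0: "P 0 = 0"
  shows "(\<Sum>d=1..q. moebius d * (\<Sum>g=1..q div d. P (q div d div g))) = P q"
proof -
  have le: "b \<le> q" if "Suc 0 \<le> k" "b * k \<le> q" for b k
    by (rule order_trans[of _ "b * k"]) (use that in auto)
  have "(\<Sum>d=1..q. moebius d * (\<Sum>g=1..q div d. P (q div d div g)))
      = (\<Sum>d=1..q. \<Sum>g=1..q div d. moebius d * P (q div (d * g)))"
    by (simp add: sum_distrib_left div_mult2_eq)
  also have "\<dots> = (\<Sum>(d, g)\<in>(SIGMA d:{1..q}. {1..q div d}). moebius d * P (q div (d * g)))"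
    by (rule sum.Sigma) auto
  also have "\<dots> = (\<Sum>(m, d)\<in>(SIGMA m:{1..q}. {d. d dvd m}). moebius d * P (q div m))"
    by (rule sum.reindex_bij_witness[where j = "\<lambda>(d, g). (d * g, d)" and i = "\<lambda>(m, d). (d, m div d)"])
       (auto simp: less_eq_div_iff_mult_less_eq mult.commute dvd_imp_le intro: dvd_pos_nat
          elim!: dvdE intro: le)
  also have "\<dots> = (\<Sum>m=1..q. \<Sum>d | d dvd m. moebius d * P (q div m))"
    by (rule sum.Sigma[symmetric]) (auto intro: finite_divisors_nat)
  also have "\<dots> = (\<Sum>m=1..q. of_int (\<Sum>d | d dvd m. moebius d) * P (q div m))"
    by (simp add: sum_distrib_right)
  also have "\<dots> = (\<Sum>m=1..q. if m = 1 then P q else 0)"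
    by (intro sum.cong refl) (auto simp: sum_moebius_divisors simp del: of_int_sum)
  \<comment> \<open>For \<open>q = 0\<close> the sum is empty, in agreement with
    \<open>P 0 = 0\<close>.\<close>
  also have "\<dots> = P q"
    using assms by (cases q) (auto simp: sum.delta)
  finally show ?thesis .
qed

section \<open>Asymptotics of floor sums\<close>

lemma tendsto_floor_ratio_Suc:
  "(\<lambda>q. (2 * real (q div Suc k) + 1) / (2 * real q + 1)) \<longlonglongrightarrow> 1 / real (Suc k)"
proof (rule tendsto_sandwich)
  have low: "2 * (real q / real (Suc k)) - 1 \<le> 2 * real (q div Suc k) + 1" for q
  proof -
    have "real q / real (Suc k) < real (q div Suc k) + 1"
      using floor_divide_of_nat_eq[of q "Suc k", where ?'a = real] by linarith
    then show ?thesis by linarith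
  qed
  show "\<forall>\<^sub>F q in sequentially. (2 * (real q / real (Suc k)) - 1) / (2 * real q + 1)
          \<le> (2 * real (q div Suc k) + 1) / (2 * real q + 1)"
    by (intro always_eventually allI divide_right_mono low) auto
  have up: "2 * real (q div Suc k) + 1 \<le> 2 * (real q / real (Suc k)) + 1" for q
    using of_nat_div_le_of_nat[of q "Suc k", where ?'a = real] by simp
  show "\<forall>\<^sub>F q in sequentially. (2 * real (q div Suc k) + 1) / (2 * real q + 1)
          \<le> (2 * (real q / real (Suc k)) + 1) / (2 * real q + 1)"
    by (intro always_eventually allI divide_right_mono up) auto
  show "(\<lambda>q. (2 * (real q / real (Suc k)) - 1) / (2 * real q + 1)) \<longlonglongrightarrow> 1 / real (Suc k)"
       "(\<lambda>q. (2 * (real q / real (Suc k)) + 1) / (2 * real q + 1)) \<longlonglongrightarrow> 1 / real (Suc k)"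
    by (real_asymp simp: field_simps)+
qed

lemma tendsto_floor_ratio:
  "(\<lambda>q. (2 * real (q div d) + 1) / (2 * real q + 1)) \<longlonglongrightarrow> 1 / real d"
proof (cases d)
  \<comment> \<open>The conventions \<open>q div 0 = 0\<close> and \<open>1 / 0 = 0\<close> keep the
    formula valid; this case will serve the trivial subgroup.\<close>
  case 0
  have "(\<lambda>q. 1 / (2 * real q + 1)) \<longlonglongrightarrow> 0"
    by real_asymp
  then show ?thesis
    by (simp add: 0)
qed (use tendsto_floor_ratio_Suc in simp)

text \<open>Tannery's theorem applies: each term converges because \<open>q div Suc k\<close> tends
  to infinity, and since the bound on \<open>a\<close> is a multiple of \<open>real q ^ n\<close>,
  the floor estimate supplies the factor \<open>1 / real (Suc k) ^ n\<close> of a summable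
  majorant.\<close>

lemma tendsto_sum_floor:
  fixes a w :: "nat \<Rightarrow> real"
  assumes lim: "(\<lambda>q. a q / (2 * real q + 1) ^ n) \<longlonglongrightarrow> C"
    and bound: "\<And>q. \<bar>a q\<bar> \<le> B * real q ^ n"
    and summable: "summable (\<lambda>k. \<bar>w (Suc k)\<bar> / real (Suc k) ^ n)"
    and a0: "a 0 = 0"
  shows "(\<lambda>q. (\<Sum>g=1..q. w g * a (q div g)) / (2 * real q + 1) ^ n)
           \<longlonglongrightarrow> C * (\<Sum>k. w (Suc k) / real (Suc k) ^ n)"
proof -
  define f where "f k q = w (Suc k) * (a (q div Suc k) / (2 * real q + 1) ^ n)" for k q
  have B: "B \<ge> 0"
    using bound[of 1] by simp
  have lim_f: "f k \<longlonglongrightarrow> w (Suc k) * (C * (1 / real (Suc k)) ^ n)" for k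
  proof -
    have top: "filterlim (\<lambda>q. q div Suc k) sequentially sequentially"
      by (intro filterlim_at_top_div_const_nat) simp
    \<comment> \<open>The quotient is factored through \<open>2 * real (q div Suc k) + 1\<close>,
      the normalisation that belongs to the argument of \<open>a\<close>.\<close>
    from tendsto_mult[OF filterlim_compose[OF lim top] tendsto_power[OF tendsto_floor_ratio[of "Suc k"], of n]]
    have "(\<lambda>q. a (q div Suc k) / (2 * real (q div Suc k) + 1) ^ n *
            ((2 * real (q div Suc k) + 1) / (2 * real q + 1)) ^ n) \<longlonglongrightarrow> C * (1 / real (Suc k)) ^ n" .
    also have "(\<lambda>q. a (q div Suc k) / (2 * real (q div Suc k) + 1) ^ n *
            ((2 * real (q div Suc k) + 1) / (2 * real q + 1)) ^ n)
          = (\<lambda>q. a (q div Suc k) / (2 * real q + 1) ^ n)"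
      by (rule ext) (simp add: power_divide add_nonneg_eq_0_iff)
    finally show ?thesis
      unfolding f_def by (intro tendsto_mult tendsto_const)
  qed
  have bound_f: "norm (f k q) \<le> B * (\<bar>w (Suc k)\<bar> / real (Suc k) ^ n)" for k q
  proof -
    have "\<bar>a (q div Suc k)\<bar> \<le> B * (real q / real (Suc k)) ^ n"
      by (rule order_trans[OF bound])
         (intro mult_left_mono power_mono of_nat_div_le_of_nat B, auto)
    also have "\<dots> \<le> B * ((2 * real q + 1) / real (Suc k)) ^ n"
      by (intro mult_left_mono power_mono divide_right_mono B) auto
    finally have "\<bar>a (q div Suc k)\<bar> / (2 * real q + 1) ^ n \<le> B / real (Suc k) ^ n"
      by (simp add: power_divide field_simps)
    then have "\<bar>w (Suc k)\<bar> * (\<bar>a (q div Suc k)\<bar> / (2 * real q + 1) ^ n)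
        \<le> \<bar>w (Suc k)\<bar> * (B / real (Suc k) ^ n)"
      by (rule mult_left_mono) simp
    then show ?thesis
      by (simp add: f_def abs_mult mult_ac)
  qed
  have "(\<lambda>q. \<Sum>k. f k q) \<longlonglongrightarrow> (\<Sum>k. w (Suc k) * (C * (1 / real (Suc k)) ^ n))"
    using tannerys_theorem[OF lim_f always_eventually summable_mult[OF summable, of B]] bound_f
    by auto
  also have "(\<Sum>k. w (Suc k) * (C * (1 / real (Suc k)) ^ n)) = (\<Sum>k. C * (w (Suc k) / real (Suc k) ^ n))"
    by (simp add: power_divide mult_ac)
  also have "\<dots> = C * (\<Sum>k. w (Suc k) / real (Suc k) ^ n)"
  proof (rule suminf_mult)
    show "summable (\<lambda>k. w (Suc k) / real (Suc k) ^ n)"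
      by (rule summable_rabs_cancel) (use summable in simp)
  qed
  also have "(\<lambda>q. \<Sum>k. f k q) = (\<lambda>q. (\<Sum>g=1..q. w g * a (q div g)) / (2 * real q + 1) ^ n)"
  proof
    fix q
    \<comment> \<open>For \<open>k \<ge> q\<close> the argument \<open>q div Suc k\<close> is 0,
      where \<open>a\<close> vanishes, so the series is a finite sum.\<close>
    have "(\<Sum>k. f k q) = (\<Sum>k<q. f k q)"
      by (rule suminf_finite) (auto simp: f_def a0)
    also have "\<dots> = (\<Sum>g=1..q. w g * (a (q div g) / (2 * real q + 1) ^ n))"
      by (rule sum.reindex_bij_witness[where j = Suc and i = "\<lambda>g. g - 1"]) (auto simp: f_def)
    finally show "(\<Sum>k. f k q) = (\<Sum>g=1..q. w g * a (q div g)) / (2 * real q + 1) ^ n"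
      by (simp add: sum_divide_distrib)
  qed
  finally show ?thesis .
qed


section \<open>The gcd of an integer tuple\<close>

definition int_box :: "'a set \<Rightarrow> nat \<Rightarrow> ('a \<Rightarrow> int) set" where
  "int_box X q = X \<rightarrow>\<^sub>E {- int q..int q}"

lemma mem_int_box_iff:
  "k \<in> int_box X q \<longleftrightarrow> k \<in> extensional X \<and> (\<forall>x\<in>X. \<bar>k x\<bar> \<le> int q)"
  by (fastforce simp: int_box_def PiE_iff abs_le_iff)

definition primitive_count :: "'a set \<Rightarrow> nat \<Rightarrow> nat" where
  "primitive_count X q = card {k \<in> int_box X q. Gcd (k ` X) = 1}"

lemma finite_int_box: "finite X \<Longrightarrow> finite (int_box X q)"
  unfolding int_box_def by (rule finite_PiE) auto

lemma card_int_box: "finite X \<Longrightarrow> card (int_box X q) = (2 * q + 1) ^ card X"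
proof -
  have "card {- int q..int q} = 2 * q + 1"
    unfolding card_atLeastAtMost_int by linarith
  then show "finite X \<Longrightarrow> card (int_box X q) = (2 * q + 1) ^ card X"
    by (simp only: int_box_def card_funcsetE)
qed

lemma int_box_Gcd_0:
  "{k \<in> int_box X q. Gcd (k ` X) = 0} = {\<lambda>x\<in>X. 0}"
proof (intro equalityI subsetI)
  fix k assume k: "k \<in> {k \<in> int_box X q. Gcd (k ` X) = 0}"
  have "k = (\<lambda>x\<in>X. 0)"
    by (rule extensionalityI[of _ X]) (use k in \<open>auto simp: int_box_def PiE_iff\<close>)
  then show "k \<in> {\<lambda>x\<in>X. 0}" by simp
qed (auto simp: int_box_def)

lemma card_int_box_Gcd_eq:
  assumes "g > 0"
  shows "card {k \<in> int_box X q. Gcd (k ` X) = int g} = primitive_count X (q div g)"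
proof -
  \<comment> \<open>An integer multiple of \<open>g\<close> is bounded by \<open>q\<close> exactly
    when the cofactor is bounded by the rounded quotient, so division by \<open>g\<close> lands in
    the box of size \<open>q div g\<close>.\<close>
  have le_iff: "\<bar>int g * i\<bar> \<le> int q \<longleftrightarrow> \<bar>i\<bar> \<le> int (q div g)" for i
  proof -
    have "int g * int j \<le> int q \<longleftrightarrow> int j \<le> int (q div g)" for j
      using assms by (simp only: less_eq_div_iff_mult_less_eq of_nat_le_iff mult.commute flip: of_nat_mult)
    from this[of "nat \<bar>i\<bar>"] show ?thesis
      by (simp add: abs_mult)
  qed
  have "bij_betw (\<lambda>k. \<lambda>x\<in>X. int g * k x) {k \<in> int_box X (q div g). Gcd (k ` X) = 1}
      {k \<in> int_box X q. Gcd (k ` X) = int g}"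
  proof (rule bij_betwI')
    fix k l assume kl: "k \<in> {k \<in> int_box X (q div g). Gcd (k ` X) = 1}"
      "l \<in> {k \<in> int_box X (q div g). Gcd (k ` X) = 1}"
    show "((\<lambda>x\<in>X. int g * k x) = (\<lambda>x\<in>X. int g * l x)) = (k = l)"
    proof
      assume eq: "(\<lambda>x\<in>X. int g * k x) = (\<lambda>x\<in>X. int g * l x)"
      show "k = l"
      proof (rule extensionalityI[of _ X])
        fix x assume "x \<in> X"
        then show "k x = l x"
          using fun_cong[OF eq, of x] assms by simp
      qed (use kl in \<open>auto simp: int_box_def PiE_iff\<close>)
    qed simp
  next
    fix k assume k: "k \<in> {k \<in> int_box X (q div g). Gcd (k ` X) = 1}"
    have "\<bar>k x\<bar> \<le> int (q div g)" if "x \<in> X" for x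
      using k that by (simp add: mem_int_box_iff)
    then have "\<bar>int g * k x\<bar> \<le> int q" if "x \<in> X" for x
      using that le_iff by blast
    then have "(\<lambda>x\<in>X. int g * k x) \<in> int_box X q"
      by (simp add: mem_int_box_iff)
    moreover have "(\<lambda>x\<in>X. int g * k x) ` X = (*) (int g) ` (k ` X)"
      by (auto simp: image_image)
    ultimately show "(\<lambda>x\<in>X. int g * k x) \<in> {k \<in> int_box X q. Gcd (k ` X) = int g}"
      using k by (simp add: Gcd_mult)
  next
    fix l assume l: "l \<in> {k \<in> int_box X q. Gcd (k ` X) = int g}"
    define k where "k = (\<lambda>x\<in>X. l x div int g)"
    have l_eq: "l x = int g * k x" if "x \<in> X" for x
    proof -
      have "int g dvd l x"
        using l that Gcd_dvd[of "l x" "l ` X"] by simp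
      then show ?thesis
        using that by (simp add: k_def)
    qed
    have "\<bar>l x\<bar> \<le> int q" if "x \<in> X" for x
      using l that by (simp add: mem_int_box_iff)
    then have "\<bar>k x\<bar> \<le> int (q div g)" if "x \<in> X" for x
      using that le_iff l_eq by metis
    then have "k \<in> int_box X (q div g)"
      by (simp add: mem_int_box_iff k_def)
    moreover have "l ` X = (*) (int g) ` (k ` X)"
      using l_eq by (auto simp: image_image)
    then have "int g * Gcd (k ` X) = int g"
      using l by (simp add: Gcd_mult abs_mult)
    then have "Gcd (k ` X) = 1"
      using assms by simp
    moreover have "l = (\<lambda>x\<in>X. int g * k x)"
      by (rule extensionalityI[of _ X]) (use l l_eq in \<open>auto simp: int_box_def PiE_iff\<close>)
    ultimately show "\<exists>k\<in>{k \<in> int_box X (q div g). Gcd (k ` X) = 1}. l = (\<lambda>x\<in>X. int g * k x)"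
      by blast
  qed
  from bij_betw_same_card[OF this] show ?thesis
    by (simp add: primitive_count_def)
qed

text \<open>A nonzero gcd divides a nonzero entry and so lies between 1 and \<open>q\<close>. Only
  the zero tuple has gcd 0, and \<open>w 0 = 0\<close> removes it.\<close>

lemma sum_int_box_Gcd:
  fixes w :: "nat \<Rightarrow> real"
  assumes "finite X" "w 0 = 0"
  shows "(\<Sum>k\<in>int_box X q. w (nat (Gcd (k ` X)))) = (\<Sum>g=1..q. w g * real (primitive_count X (q div g)))"
proof -
  define S where "S = {k \<in> int_box X q. Gcd (k ` X) \<noteq> 0}"
  have fin: "finite S"
    using finite_int_box[OF assms(1)] by (simp add: S_def)
  have "(\<Sum>k\<in>int_box X q. w (nat (Gcd (k ` X)))) = (\<Sum>k\<in>S. w (nat (Gcd (k ` X))))"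
    by (rule sum.mono_neutral_right[OF finite_int_box[OF assms(1)]]) (auto simp: S_def assms(2) simp del: Gcd_0_iff)
  also have "\<dots> = (\<Sum>g=1..q. \<Sum>k | k \<in> S \<and> nat (Gcd (k ` X)) = g. w (nat (Gcd (k ` X))))"
  proof (rule sum.group[symmetric, OF fin])
    show "(\<lambda>k. nat (Gcd (k ` X))) ` S \<subseteq> {1..q}"
    proof (rule image_subsetI)
      fix k assume k: "k \<in> S"
      then obtain x where x: "x \<in> X" "k x \<noteq> 0"
        by (auto simp: S_def)
      have "Gcd (k ` X) dvd k x"
        using x by simp
      then have "\<bar>Gcd (k ` X)\<bar> \<le> \<bar>k x\<bar>"
        using x(2) dvd_imp_le_int by blast
      also have "\<bar>k x\<bar> \<le> int q"
        using k x by (simp add: S_def mem_int_box_iff)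
      finally have "Gcd (k ` X) \<le> int q"
        by simp
      moreover have "Gcd (k ` X) > 0"
        using k Gcd_int_greater_eq_0[of "k ` X"] unfolding S_def by (simp add: order_less_le)
      ultimately show "nat (Gcd (k ` X)) \<in> {1..q}"
        by auto
    qed
  qed simp
  also have "\<dots> = (\<Sum>g=1..q. w g * real (primitive_count X (q div g)))"
  proof (intro sum.cong refl)
    fix g assume g: "g \<in> {1..q}"
    have "{k. k \<in> S \<and> nat (Gcd (k ` X)) = g} = {k \<in> int_box X q. Gcd (k ` X) = int g}"
      using g by (auto simp: S_def simp del: Gcd_0_iff)
    then show "(\<Sum>k | k \<in> S \<and> nat (Gcd (k ` X)) = g. w (nat (Gcd (k ` X))))
        = w g * real (primitive_count X (q div g))"
      using card_int_box_Gcd_eq[of g X q] g by simp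
  qed
  finally show ?thesis .
qed

text \<open>Every tuple except the zero one has a positive gcd, so weight 1 counts the whole box
  minus one point.\<close>

lemma sum_primitive_count:
  assumes "finite X"
  shows "(\<Sum>g=1..q. real (primitive_count X (q div g))) = (2 * real q + 1) ^ card X - 1"
proof -
  have "(\<Sum>g=1..q. real (primitive_count X (q div g))) = (\<Sum>g=1..q. of_bool (g \<noteq> 0) * real (primitive_count X (q div g)))"
    by (intro sum.cong) auto
  also have "\<dots> = (\<Sum>k\<in>int_box X q. of_bool (nat (Gcd (k ` X)) \<noteq> 0))"
    by (rule sum_int_box_Gcd[symmetric, OF assms]) simp
  also have "\<dots> = (\<Sum>k\<in>int_box X q. 1 - of_bool (Gcd (k ` X) = 0))"
  proof (intro sum.cong refl)
    fix k :: "'a \<Rightarrow> int"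
    have "Gcd (k ` X) = 0" if "Gcd (k ` X) \<le> 0"
      using that Gcd_int_greater_eq_0 by (rule order_antisym)
    then show "of_bool (nat (Gcd (k ` X)) \<noteq> 0) = (1 - of_bool (Gcd (k ` X) = 0) :: real)"
      by (auto simp del: Gcd_0_iff)
  qed
  also have "\<dots> = real (card (int_box X q)) - real (card {k \<in> int_box X q. Gcd (k ` X) = 0})"
    using finite_int_box[OF assms] by (simp add: sum_subtractf sum.inter_filter[symmetric] of_bool_def)
  finally show ?thesis
    by (simp only: int_box_Gcd_0 card_int_box[OF assms]) (simp add: add.commute)
qed

lemma primitive_count_0 [simp]: "primitive_count X 0 = 0"
proof -
  have "Gcd (k ` X) = 0" if "k \<in> int_box X 0" for k
    using that by (auto simp: int_box_def PiE_iff)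
  then have "{k \<in> int_box X 0. Gcd (k ` X) = 1} = {}"
    by (auto simp del: Gcd_0_iff)
  then show ?thesis
    by (simp only: primitive_count_def card.empty)
qed

text \<open>The constant comes from \<open>2 * q + 1 \<le> 3 * q\<close> for positive
  \<open>q\<close>; at 0 the count vanishes. The bound is a pure multiple of
  \<open>real q ^ card X\<close>, the form that \<open>tendsto_sum_floor\<close> asks for.\<close>

lemma primitive_count_le:
  assumes "finite X"
  shows "real (primitive_count X q) \<le> 3 ^ card X * real q ^ card X"
proof (cases "q = 0")
  case False
  have "primitive_count X q \<le> (2 * q + 1) ^ card X"
    unfolding primitive_count_def card_int_box[OF assms, symmetric]
    by (rule card_mono[OF finite_int_box[OF assms]]) auto
  also have "\<dots> \<le> (3 * q) ^ card X"
    using False by (intro power_mono) auto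
  finally have "real (primitive_count X q) \<le> real ((3 * q) ^ card X)"
    by (rule of_nat_mono)
  then show ?thesis
    by (simp add: power_mult_distrib)
qed simp

section \<open>The proportion of primitive tuples and the mean inverse gcd\<close>

lemma summable_inverse_Suc_power:
  assumes "n \<ge> 2"
  shows "summable (\<lambda>k. 1 / real (Suc k) ^ n)"
  using inverse_power_summable[OF assms, where ?'a = real]
  by (subst summable_Suc_iff) (simp add: inverse_eq_divide)

lemma zeta_of_nat: "zeta (real n) = (\<Sum>k. 1 / real (Suc k) ^ n)"
  by (simp add: zeta_def powr_realpow)

text \<open>Moebius inversion only shows that the limit \<open>C\<close> exists; its value comes from summing
  \<open>P (q div g)\<close> over \<open>g\<close> in two ways, which gives \<open>C * zeta n = 1\<close>.\<close>

lemma primitive_density: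
  assumes "finite X" "card X \<ge> 2"
  shows "(\<lambda>q. real (primitive_count X q) / (2 * real q + 1) ^ card X) \<longlonglongrightarrow> 1 / zeta (real (card X))"
proof -
  define n where "n = card X"
  define P where "P q = real (primitive_count X q)" for q
  define T where "T q = (2 * real q + 1) ^ n - 1" for q
  define C where "C = (\<Sum>k. real_of_int (moebius (Suc k)) / real (Suc k) ^ n)"
  have n: "n \<ge> 2"
    using assms(2) by (simp add: n_def)
  have T: "(\<Sum>g=1..q. P (q div g)) = T q" for q
    unfolding P_def T_def n_def by (rule sum_primitive_count[OF assms(1)])
  have "(\<lambda>q. 1 - (1 / (2 * real q + 1)) ^ n) \<longlonglongrightarrow> 1 - 0 ^ n"
    by (intro tendsto_intros tendsto_power) real_asymp
  moreover have "1 - (1 / (2 * real q + 1)) ^ n = T q / (2 * real q + 1) ^ n" for q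
    by (simp add: T_def power_divide diff_divide_distrib add_nonneg_eq_0_iff)
  ultimately have T_lim: "(\<lambda>q. T q / (2 * real q + 1) ^ n) \<longlonglongrightarrow> 1"
    using n by (simp add: zero_power)
  have T_bound: "\<bar>T q\<bar> \<le> 3 ^ n * real q ^ n" for q
  proof (cases "q = 0")
    case False
    then have "(2 * real q + 1) ^ n \<le> (3 * real q) ^ n"
      by (intro power_mono) auto
    moreover have "1 \<le> (2 * real q + 1) ^ n"
      by (rule one_le_power) simp
    ultimately show ?thesis
      by (simp add: T_def power_mult_distrib)
  qed (simp add: T_def)
  \<comment> \<open>\<open>T\<close> counts the nonzero tuples, so its limit is elementary; its
    Moebius sum is \<open>P\<close>, whose limit thereby exists.\<close>
  have "(\<lambda>q. (\<Sum>d=1..q. real_of_int (moebius d) * T (q div d)) / (2 * real q + 1) ^ n) \<longlonglongrightarrow> 1 * C"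
    unfolding C_def
  proof (rule tendsto_sum_floor[OF T_lim T_bound])
    show "summable (\<lambda>k. \<bar>real_of_int (moebius (Suc k))\<bar> / real (Suc k) ^ n)"
    proof (rule summable_comparison_test'[OF summable_inverse_Suc_power[OF n]])
      fix k :: nat
      have "\<bar>real_of_int (moebius (Suc k))\<bar> \<le> 1"
        using abs_moebius_le[of "Suc k"] by linarith
      then show "norm (\<bar>real_of_int (moebius (Suc k))\<bar> / real (Suc k) ^ n) \<le> 1 / real (Suc k) ^ n"
        by (simp add: divide_right_mono)
    qed
  qed (simp add: T_def)
  moreover have "(\<Sum>d=1..q. real_of_int (moebius d) * T (q div d)) = P q" for q
    unfolding T[symmetric] by (rule moebius_inversion_floor) (simp add: P_def)
  ultimately have P_lim: "(\<lambda>q. P q / (2 * real q + 1) ^ n) \<longlonglongrightarrow> C"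
    by simp
  have P_bound: "\<bar>P q\<bar> \<le> 3 ^ n * real q ^ n" for q
    using primitive_count_le[OF assms(1), of q] by (simp add: P_def n_def)
  have "(\<lambda>q. (\<Sum>g=1..q. 1 * P (q div g)) / (2 * real q + 1) ^ n)
      \<longlonglongrightarrow> C * (\<Sum>k. 1 / real (Suc k) ^ n)"
    by (rule tendsto_sum_floor[OF P_lim P_bound])
       (use summable_inverse_Suc_power[OF n] in \<open>simp_all add: P_def\<close>)
  then have "(\<lambda>q. T q / (2 * real q + 1) ^ n) \<longlonglongrightarrow> C * zeta (real n)"
    by (simp only: mult_1 T zeta_of_nat)
  with T_lim have "C * zeta (real n) = 1"
    using LIMSEQ_unique by blast
  \<comment> \<open>The product being 1 excludes \<open>zeta (real n) = 0\<close>, so division is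
    legitimate.\<close>
  then have "C = 1 / zeta (real n)"
    by (simp add: eq_divide_eq) (metis mult_zero_right zero_neq_one)
  with P_lim show ?thesis
    by (simp add: P_def n_def)
qed

text \<open>Only the exponents 1 and -1 have gcd 1, at most two out of \<open>2 * q + 1\<close>. The
  limit 0 takes the place of the reciprocal of the zeta series, which diverges at 1.\<close>

lemma primitive_density_1:
  assumes "card X = 1"
  shows "(\<lambda>q. real (primitive_count X q) / (2 * real q + 1) ^ card X) \<longlonglongrightarrow> 0"
proof -
  obtain x where X: "X = {x}"
    using assms by (auto simp: card_1_singleton_iff)
  have le: "primitive_count X q \<le> 2" for q
  proof -
    have "primitive_count X q \<le> card {1, - 1 :: int}"
      unfolding primitive_count_def
    proof (rule card_inj_on_le[where f = "\<lambda>k. k x"])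
      show "inj_on (\<lambda>k. k x) {k \<in> int_box X q. Gcd (k ` X) = 1}"
        by (auto simp: inj_on_def int_box_def X intro: PiE_ext)
    qed (auto simp: X abs_eq_iff')
    then show ?thesis by simp
  qed
  have "(\<lambda>q. 2 / (2 * real q + 1)) \<longlonglongrightarrow> 0"
    by real_asymp
  then show ?thesis
  proof (rule tendsto_sandwich[OF always_eventually always_eventually tendsto_const, rotated 2])
    show "\<forall>q. real (primitive_count X q) / (2 * real q + 1) ^ card X \<le> 2 / (2 * real q + 1)"
    proof
      fix q
      have "real (primitive_count X q) \<le> 2"
        using le[of q] by simp
      then show "real (primitive_count X q) / (2 * real q + 1) ^ card X \<le> 2 / (2 * real q + 1)"
        by (simp add: assms divide_right_mono)
    qed
  qed simp
qed

text \<open>Weighting by \<open>1 / g\<close> raises the exponent of the series by one, so that it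
  converges already for one generator. The limit \<open>C\<close> stays arbitrary in order to cover
  one generator as well as several; the zero tuple contributes \<open>1 / 0 = 0\<close>.\<close>

lemma mean_inverse_Gcd:
  assumes "finite X" "card X \<ge> 1"
    and C: "(\<lambda>q. real (primitive_count X q) / (2 * real q + 1) ^ card X) \<longlonglongrightarrow> C"
  shows "(\<lambda>q. (\<Sum>k\<in>int_box X q. 1 / real (nat (Gcd (k ` X)))) / (2 * real q + 1) ^ card X)
           \<longlonglongrightarrow> C * zeta (real (card X) + 1)"
proof -
  have "(\<lambda>q. (\<Sum>g=1..q. 1 / real g * real (primitive_count X (q div g))) / (2 * real q + 1) ^ card X)
          \<longlonglongrightarrow> C * (\<Sum>k. 1 / real (Suc k) / real (Suc k) ^ card X)"
  proof (rule tendsto_sum_floor[OF C])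
    show "summable (\<lambda>k. \<bar>1 / real (Suc k)\<bar> / real (Suc k) ^ card X)"
      using summable_inverse_Suc_power[of "Suc (card X)"] assms(2) by simp
  qed (use primitive_count_le[OF assms(1)] in auto)
  moreover have "(\<Sum>k. 1 / real (Suc k) / real (Suc k) ^ card X) = zeta (real (card X) + 1)"
    using zeta_of_nat[of "Suc (card X)"] by (simp add: add.commute)
  moreover have "(\<Sum>k\<in>int_box X q. 1 / real (nat (Gcd (k ` X))))
      = (\<Sum>g=1..q. 1 / real g * real (primitive_count X (q div g)))" for q
    by (rule sum_int_box_Gcd[OF assms(1)]) simp
  ultimately show ?thesis
    by simp
qed


section \<open>Infinite cyclic targets\<close>

definition power_word :: "'a \<Rightarrow> int \<Rightarrow> ('a \<times> bool) list" where
  "power_word y i = replicate (nat \<bar>i\<bar>) (y, 0 \<le> i)"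

lemma length_power_word [simp]: "length (power_word y i) = nat \<bar>i\<bar>"
  by (simp add: power_word_def)

lemma power_word_reduced: "power_word y i \<in> reduced_words {y}"
proof -
  have "replicate n (y, b) \<in> reduced_words {y}" for n b
    by (induction n) (auto simp: Cons_reduced_iff inv_letter_def hd_replicate)
  then show ?thesis
    by (simp add: power_word_def)
qed

lemma power_word_inject:
  assumes "power_word y i = power_word y j"
  shows "i = j"
proof -
  have abs: "\<bar>i\<bar> = \<bar>j\<bar>"
    using arg_cong[OF assms, of length] by simp
  show ?thesis
  proof (cases "i = 0")
    case False
    then have "hd (power_word y i) = (y, 0 \<le> i)" "hd (power_word y j) = (y, 0 \<le> j)"
      using abs by (auto simp: power_word_def hd_replicate)
    with assms abs show ?thesis
      by auto
  qed (use abs in simp)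
qed

text \<open>Neighbouring letters share the generator, hence by reducedness also the sign, so the
  word is constant.\<close>

lemma reduced_words_singleton:
  assumes "w \<in> reduced_words {y}"
  obtains i where "w = power_word y i"
proof -
  have "w = replicate (length w) (hd w)" if "w \<in> reduced_words {y}" for w
    using that
  proof (induction w)
    case (Cons s w)
    then have w: "w \<in> reduced_words {y}" and s: "fst s = y"
      and hd: "w = [] \<or> hd w \<noteq> inv_letter s"
      by (auto simp: Cons_reduced_iff)
    have "hd w = s" if "w \<noteq> []"
    proof -
      have "fst (hd w) = y"
        using reduced_words_letters[OF w] hd_in_set[OF that] by auto
      then show ?thesis
        using hd that s by (auto simp: inv_letter_def prod_eq_iff)
    qed
    then show ?case
      using Cons.IH[OF w] by (cases "w = []") auto
  qed simp
  from this[OF assms] have w: "w = replicate (length w) (hd w)" .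
  show ?thesis
  proof (cases "w = []")
    case True
    then show ?thesis
      using that[of 0] by (simp add: power_word_def)
  next
    case False
    then obtain b where "hd w = (y, b)"
      using reduced_words_letters[OF assms] hd_in_set[OF False] by fastforce
    then have "w = power_word y (if b then int (length w) else - int (length w))"
      using False by (subst w) (auto simp: power_word_def)
    then show ?thesis
      by (rule that)
  qed
qed

text \<open>Bezout's identity writes \<open>gcd a (Gcd A)\<close> as an integer combination, so
  induction on the finite set keeps the gcd inside the subgroup \<open>I\<close>.\<close>

lemma Gcd_mem_additive:
  fixes I :: "int set"
  assumes "finite A" "A \<subseteq> I" "0 \<in> I"
    and add: "\<And>i j. i \<in> I \<Longrightarrow> j \<in> I \<Longrightarrow> i + j \<in> I" and neg: "\<And>i. i \<in> I \<Longrightarrow> - i \<in> I"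
  shows "c * Gcd A \<in> I"
proof -
  have mult: "c * i \<in> I" if "i \<in> I" for c i
  proof (induction c rule: int_induct[where k = 0])
    case (step1 c)
    then show ?case
      using add[OF _ that, of "c * i"] by (simp add: algebra_simps)
  next
    case (step2 c)
    then show ?case
      using add[OF _ neg[OF that], of "c * i"] by (simp add: algebra_simps)
  qed (simp add: \<open>0 \<in> I\<close>)
  have "Gcd A \<in> I"
    using assms(1,2)
  proof (induction A rule: finite_induct)
    case (insert a A)
    obtain u v where "u * a + v * Gcd A = gcd a (Gcd A)"
      using bezout_int by blast
    then show ?case
      using insert add mult by (metis Gcd_insert insert_subset)
  qed (simp add: \<open>0 \<in> I\<close>)
  then show ?thesis
    by (rule mult)
qed

lemma card_multiples: "card {i. int d dvd i \<and> \<bar>i\<bar> \<le> int p} = 2 * (p div d) + 1"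
proof (cases "d = 0")
  case True
  then have "{i. int d dvd i \<and> \<bar>i\<bar> \<le> int p} = {0}"
    by auto
  then show ?thesis
    using True by simp
next
  case False
  have le_iff: "\<bar>int d * i\<bar> \<le> int p \<longleftrightarrow> \<bar>i\<bar> \<le> int (p div d)" for i
  proof -
    have "int d * int j \<le> int p \<longleftrightarrow> int j \<le> int (p div d)" for j
      using False by (simp only: less_eq_div_iff_mult_less_eq of_nat_le_iff mult.commute neq0_conv flip: of_nat_mult)
    from this[of "nat \<bar>i\<bar>"] show ?thesis
      by (simp add: abs_mult)
  qed
  have "{i. int d dvd i \<and> \<bar>i\<bar> \<le> int p} = (*) (int d) ` {- int (p div d)..int (p div d)}"
  proof (intro equalityI subsetI)
    fix i assume "i \<in> {i. int d dvd i \<and> \<bar>i\<bar> \<le> int p}"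
    then obtain j where "i = int d * j" "\<bar>j\<bar> \<le> int (p div d)"
      using le_iff by (auto simp: dvd_def)
    then show "i \<in> (*) (int d) ` {- int (p div d)..int (p div d)}"
      by (intro image_eqI[of _ _ j]) (simp_all add: abs_le_iff)
  next
    fix i assume "i \<in> (*) (int d) ` {- int (p div d)..int (p div d)}"
    then obtain j where i: "i = int d * j" and j: "j \<in> {- int (p div d)..int (p div d)}"
      by blast
    have "\<bar>j\<bar> \<le> int (p div d)"
      using j unfolding atLeastAtMost_iff by linarith
    then show "i \<in> {i. int d dvd i \<and> \<bar>i\<bar> \<le> int p}"
      using le_iff[of j] by (simp add: i)
  qed
  then have "card {i. int d dvd i \<and> \<bar>i\<bar> \<le> int p} = card {- int (p div d)..int (p div d)}"
    using False by (simp add: card_image inj_on_def)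
  also have "\<dots> = 2 * (p div d) + 1"
    unfolding card_atLeastAtMost_int by linarith
  finally show ?thesis .
qed

locale infinite_cyclic = free_group H "{y}" for H (structure) and y
begin

abbreviation pw :: "int \<Rightarrow> 'a" where "pw i \<equiv> y [^] i"

lemma y_closed [simp]: "y \<in> carrier H"
  using basis_subset by simp

lemma word_val_power_word: "word_val H (power_word y i) = pw i"
proof -
  have rep: "word_val H (replicate n (y, b)) = letter_val H (y, b) [^] n" for n :: nat and b
  proof (induction n)
    case (Suc n)
    have "letter_val H (y, b) \<in> carrier H"
      by (simp add: letter_val_closed)
    from nat_pow_Suc2[OF this, of n] show ?case
      using Suc by (simp add: word_val_Cons)
  qed simp
  show ?thesis
  proof (cases "0 \<le> i")
    case True
    then obtain n where "i = int n"
      using nonneg_int_cases by blast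
    then show ?thesis
      by (simp add: power_word_def rep letter_val_def int_pow_int)
  next
    case False
    then obtain n where "i = - int n" "n > 0"
      by (intro that[of "nat (- i)"]) simp_all
    then show ?thesis
      by (simp add: power_word_def rep letter_val_def int_pow_neg_int nat_pow_inv)
  qed
qed

lemma pw_inject: "pw i = pw j \<longleftrightarrow> i = j"
proof
  assume "pw i = pw j"
  then have "power_word y i = power_word y j"
    using reduced_form_word_val[OF power_word_reduced] word_val_power_word by metis
  then show "i = j"
    by (rule power_word_inject)
qed simp

lemma word_ball_eq: "word_ball H {y} p = pw ` {i. \<bar>i\<bar> \<le> int p}"
proof (intro equalityI subsetI)
  fix g assume "g \<in> word_ball H {y} p"
  then have g: "g \<in> carrier H" "length (reduced_form g) \<le> p"
    by (simp_all add: word_ball_def word_length_def)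
  obtain i where i: "reduced_form g = power_word y i"
    using reduced_words_singleton[OF reduced_form_reduced[OF g(1)]] .
  then have "g = pw i" "\<bar>i\<bar> \<le> int p"
    using word_val_reduced_form[OF g(1)] g(2) word_val_power_word by auto
  then show "g \<in> pw ` {i. \<bar>i\<bar> \<le> int p}"
    by blast
next
  fix g assume "g \<in> pw ` {i. \<bar>i\<bar> \<le> int p}"
  then obtain i where "g = pw i" "\<bar>i\<bar> \<le> int p"
    by blast
  then show "g \<in> word_ball H {y} p"
    using word_length_word_val[OF power_word_reduced, of i]
    by (simp add: word_ball_def word_val_power_word)
qed

lemma card_word_ball_eq: "card (word_ball H {y} p) = 2 * p + 1"
  using card_multiples[of 1 p]
  by (simp add: word_ball_eq card_image inj_on_def pw_inject)

text \<open>For \<open>d = 0\<close> this is the trivial subgroup, of density \<open>0 = 1 / 0\<close>; the conventions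
  \<open>p div 0 = 0\<close> and \<open>1 / 0 = 0\<close> make the general formulas valid in this case.\<close>

lemma density_multiples: "density H {y} c (pw ` {i. int d dvd i}) = 1 / real d"
proof -
  have "pw ` {i. int d dvd i} \<inter> word_ball H {y} p = pw ` {i. int d dvd i \<and> \<bar>i\<bar> \<le> int p}" for p
    by (auto simp: word_ball_eq pw_inject)
  then have "card (pw ` {i. int d dvd i} \<inter> word_ball H {y} p) = 2 * (p div d) + 1" for p
    using card_multiples[of d p] by (simp add: card_image inj_on_def pw_inject)
  then have "density_seq H {y} (pw ` {i. int d dvd i}) = (\<lambda>p. (2 * real (p div d) + 1) / (2 * real p + 1))"
    by (simp add: density_seq_def card_word_ball_eq fun_eq_iff add.commute)
  then show ?thesis
    using tendsto_floor_ratio by (intro density_eqI) simp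
qed

text \<open>The exponents occurring in the image form the subgroup of the integers generated by the
  \<open>k x\<close>, which by Bezout consists of the multiples of their gcd.\<close>

lemma word_val_image_eq:
  assumes "finite X"
  shows "(\<lambda>w. word_val H (map (apfst (\<lambda>x\<in>X. pw (k x))) w)) ` reduced_words X
           = pw ` {i. Gcd (k ` X) dvd i}"
proof -
  define f where "f = (\<lambda>x\<in>X. pw (k x))"
  \<comment> \<open>Arbitrary words are allowed, so that concatenation and \<open>inv_word\<close>
    give closure under addition and negation; \<open>reduce\<close> returns to reduced words at the
    end.\<close>
  define I where "I = {i. \<exists>w. set w \<subseteq> X \<times> UNIV \<and> word_val H (map (apfst f) w) = pw i}"
  have f: "f \<in> X \<rightarrow> carrier H"
    by (auto simp: f_def)
  have val: "\<exists>i. Gcd (k ` X) dvd i \<and> word_val H (map (apfst f) w) = pw i" if "set w \<subseteq> X \<times> UNIV" for w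
    using that
  proof (induction w)
    case (Cons s w)
    then obtain i where i: "Gcd (k ` X) dvd i" "word_val H (map (apfst f) w) = pw i"
      by auto
    obtain x b where s: "s = (x, b)" "x \<in> X"
      using Cons.prems by (cases s) auto
    define j where "j = (if b then k x else - k x)"
    have "letter_val H (apfst f s) = pw j"
      using s by (simp add: letter_val_def f_def j_def int_pow_neg)
    then have "word_val H (map (apfst f) (s # w)) = pw (j + i)"
      by (simp add: word_val_Cons i(2) int_pow_mult)
    moreover have "Gcd (k ` X) dvd j"
      using s by (simp add: j_def)
    ultimately show ?case
      using i(1) by (blast intro: dvd_add)
  qed (auto intro!: exI[of _ 0])
  have I_multiples: "I = {i. Gcd (k ` X) dvd i}"
  proof (intro equalityI subsetI)
    fix i assume "i \<in> I"
    then obtain w where w: "set w \<subseteq> X \<times> UNIV" "word_val H (map (apfst f) w) = pw i"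
      by (auto simp: I_def)
    then show "i \<in> {i. Gcd (k ` X) dvd i}"
      using val[OF w(1)] by (auto simp: pw_inject)
  next
    fix i assume "i \<in> {i. Gcd (k ` X) dvd i}"
    then obtain c where c: "i = c * Gcd (k ` X)"
      by (auto simp: dvd_def mult.commute)
    have "c * Gcd (k ` X) \<in> I"
    proof (rule Gcd_mem_additive)
      show "k ` X \<subseteq> I"
      proof (rule image_subsetI)
        fix x assume "x \<in> X"
        then have "set [(x, True)] \<subseteq> X \<times> UNIV" "word_val H (map (apfst f) [(x, True)]) = pw (k x)"
          by (simp_all add: word_val_Cons letter_val_def f_def)
        then show "k x \<in> I"
          unfolding I_def by blast
      qed
      show "0 \<in> I"
        unfolding I_def by (auto intro!: exI[of _ "[]"])
    next
      fix i j assume "i \<in> I" "j \<in> I"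
      then obtain v w where vw: "set v \<subseteq> X \<times> UNIV" "word_val H (map (apfst f) v) = pw i"
          "set w \<subseteq> X \<times> UNIV" "word_val H (map (apfst f) w) = pw j"
        by (auto simp: I_def)
      then have "word_val H (map (apfst f) (v @ w)) = pw (i + j)"
        using set_map_apfst_subset[OF f vw(1)] set_map_apfst_subset[OF f vw(3)]
        by (simp add: word_val_append int_pow_mult del: set_map)
      moreover have "set (v @ w) \<subseteq> X \<times> UNIV"
        using vw by simp
      ultimately show "i + j \<in> I"
        unfolding I_def by blast
    next
      fix i assume "i \<in> I"
      then obtain w where w: "set w \<subseteq> X \<times> UNIV" "word_val H (map (apfst f) w) = pw i"
        by (auto simp: I_def)
      have "map (apfst f) (inv_word w) = inv_word (map (apfst f) w)"
        by (simp add: inv_word_def rev_map inv_letter_def)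
      then have "word_val H (map (apfst f) (inv_word w)) = pw (- i)"
        using word_val_inv_word[OF set_map_apfst_subset[OF f w(1)]] w(2) by (simp add: int_pow_neg)
      moreover have "set (inv_word w) \<subseteq> X \<times> UNIV"
        using w(1) by (auto simp: inv_word_def inv_letter_def)
      ultimately show "- i \<in> I"
        unfolding I_def by blast
    qed (use assms in simp)
    then show "i \<in> I"
      by (simp add: c)
  qed
  have "(\<lambda>w. word_val H (map (apfst f) w)) ` reduced_words X = pw ` I"
  proof (intro equalityI subsetI)
    fix g assume "g \<in> (\<lambda>w. word_val H (map (apfst f) w)) ` reduced_words X"
    then show "g \<in> pw ` I"
      using val reduced_words_letters unfolding I_def by fast
  next
    fix g assume "g \<in> pw ` I"
    then obtain w where w: "set w \<subseteq> X \<times> UNIV" "g = word_val H (map (apfst f) w)"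
      by (auto simp: I_def)
    then have "g = word_val H (map (apfst f) (reduce w))"
      using word_val_map_reduce[OF f] by simp
    then show "g \<in> (\<lambda>w. word_val H (map (apfst f) w)) ` reduced_words X"
      using reduce_reduced[OF w(1)] by blast
  qed
  then show ?thesis
    by (simp add: I_multiples f_def)
qed

lemma bij_betw_int_box:
  "bij_betw (\<lambda>k. \<lambda>x\<in>X. pw (k x)) (int_box X p) (X \<rightarrow>\<^sub>E word_ball H {y} p)"
proof (rule bij_betwI')
  fix k l assume kl: "k \<in> int_box X p" "l \<in> int_box X p"
  show "((\<lambda>x\<in>X. pw (k x)) = (\<lambda>x\<in>X. pw (l x))) = (k = l)"
  proof
    assume eq: "(\<lambda>x\<in>X. pw (k x)) = (\<lambda>x\<in>X. pw (l x))"
    show "k = l"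
    proof (rule extensionalityI[of _ X])
      fix x assume "x \<in> X"
      then show "k x = l x"
        using fun_cong[OF eq, of x] by (simp add: pw_inject)
    qed (use kl in \<open>simp_all add: mem_int_box_iff\<close>)
  qed simp
next
  fix k assume "k \<in> int_box X p"
  then show "(\<lambda>x\<in>X. pw (k x)) \<in> X \<rightarrow>\<^sub>E word_ball H {y} p"
    by (auto simp: word_ball_eq mem_int_box_iff)
next
  fix f assume f: "f \<in> X \<rightarrow>\<^sub>E word_ball H {y} p"
  then have "\<forall>x\<in>X. \<exists>i. f x = pw i \<and> \<bar>i\<bar> \<le> int p"
    by (auto simp: word_ball_eq PiE_iff)
  then obtain k where k: "\<forall>x\<in>X. f x = pw (k x) \<and> \<bar>k x\<bar> \<le> int p"
    by metis
  have "restrict k X \<in> int_box X p"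
    using k by (simp add: mem_int_box_iff)
  moreover have "f = (\<lambda>x\<in>X. pw (restrict k X x))"
    by (rule extensionalityI[of _ X]) (use f k in \<open>auto simp: PiE_iff\<close>)
  ultimately show "\<exists>k\<in>int_box X p. f = (\<lambda>x\<in>X. pw (k x))"
    by blast
qed

end

text \<open>Exponents identify the tuples in the ball with the integer box, and the density of each
  image depends only on the gcd of the exponents.\<close>

lemma mean_density_rank_1:
  assumes "free_group G X" "finite X" "infinite_cyclic H y"
  shows "mean_density G X H {y} c p =
    (\<Sum>k\<in>int_box X p. 1 / real (nat (Gcd (k ` X)))) / (2 * real p + 1) ^ card X"
proof -
  interpret G: free_group G X by fact
  interpret H: infinite_cyclic H y by fact
  have "density H {y} c ((\<lambda>w. word_val H (map (apfst (\<lambda>x\<in>X. H.pw (k x))) w)) ` reduced_words X)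
      = 1 / real (nat (Gcd (k ` X)))" for k
    using H.density_multiples[of c "nat (Gcd (k ` X))"] by (simp add: H.word_val_image_eq[OF assms(2)])
  then show ?thesis
    by (simp add: G.mean_density_eq[OF H.is_group] H.card_word_ball_eq add.commute
        flip: sum.reindex_bij_betw[OF H.bij_betw_int_box])
qed

theorem theorem9:
  fixes G :: "('a, 'm) monoid_scheme" and X :: "'a set"
    and H :: "('b, 'n) monoid_scheme" and Y :: "'b set"
    and c :: "'b set \<Rightarrow> real"
  assumes "free_basis G X" and "finite X"
    and "free_basis H Y" and "finite Y"
    and "\<And>S. 0 \<le> c S \<and> c S \<le> 1"
  shows "(card Y = 1 \<and> card X > 1 \<longrightarrow>
            has_expected_density G X H Y c
              (zeta (real (card X) + 1) / zeta (real (card X)))) \<and>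
         ((card X = 1 \<and> card Y = 1) \<or> card Y > 1 \<longrightarrow>
            has_expected_density G X H Y c 0)"
proof -
  have G: "free_group G X" and H: "free_group H Y"
    using assms by (simp_all add: free_group_def free_group_axioms_def free_basis_def)
  \<comment> \<open>Both claims for cyclic \<open>H\<close> come from this one limit;
    \<open>C\<close> will be \<open>1 / zeta (real (card X))\<close> when \<open>G\<close> has rank
    above 1, and 0 when it has rank 1.\<close>
  have mean_limit: "mean_density G X H Y c \<longlonglongrightarrow> C * zeta (real (card X) + 1)"
    if "card Y = 1" "card X \<ge> 1"
      "(\<lambda>q. real (primitive_count X q) / (2 * real q + 1) ^ card X) \<longlonglongrightarrow> C" for C
  proof -
    obtain y where Y: "Y = {y}"
      using \<open>card Y = 1\<close> by (auto simp: card_1_singleton_iff)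
    then have "infinite_cyclic H y"
      using H by (simp add: infinite_cyclic_def)
    then have "mean_density G X H Y c = (\<lambda>p. (\<Sum>k\<in>int_box X p. 1 / real (nat (Gcd (k ` X)))) /
        (2 * real p + 1) ^ card X)"
      unfolding Y by (intro ext mean_density_rank_1 G assms(2))
    then show ?thesis
      using mean_inverse_Gcd[OF assms(2) that(2,3)] by simp
  qed
  show ?thesis
    unfolding has_expected_density_def
  proof (intro conjI impI)
    assume "card Y = 1 \<and> card X > 1"
    then show "mean_density G X H Y c \<longlonglongrightarrow> zeta (real (card X) + 1) / zeta (real (card X))"
      using mean_limit primitive_density[OF assms(2)] by fastforce
  next
    assume "(card X = 1 \<and> card Y = 1) \<or> card Y > 1"
    then show "mean_density G X H Y c \<longlonglongrightarrow> 0"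
    proof
      assume "card X = 1 \<and> card Y = 1"
      then show ?thesis
        using mean_limit[OF _ _ primitive_density_1] by simp
    next
      assume "card Y > 1"
      then show ?thesis
        by (intro expected_density_rank_gt_1 G H assms) simp
    qed
  qed
qed

end
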